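(* Let $\Gamma$ be a splice diagram with $n$ leaves satisfying the edge determinant and semigroup conditions and let $\mathcal{S}(\Gamma)$ be a splice type system for $\Gamma$. Then for every star-full subtree $T$ of $\Gamma$ we have $\Delta_T\cap\mathrm{Trop}^{+}\mathcal{S}(\Gamma)\subseteq\rho(T)$, where $\Delta_T=\mathrm{conv}\{\rho(u):u\text{ a leaf of }T\}$.
   Context: A splice diagram is a finite tree $\Gamma$ with at least one vertex of valency $\geq3$ and no vertex of valency $2$; vertices of valency $1$ are leaves, others nodes; $\delta_v$ is the valency of $v$. For each node $v$ and edge $e$ at $v$ a positive integer weight $d_{v,e}$ is given; $d_v=\prod_{e\ni v}d_{v,e}$; $d_{v,u}$ is the weight at $v$ of the edge toward $u$. For distinct vertices $u,v$, $\ell_{u,v}$ is the product of all $d_{w,e}$ with $w$ a node on the geodesic $[u,v]$ and $e$ an edge at $w$ not in $[u,v]$; $\ell_{v,v}=d_v$. Edge determinant condition: $d_{u,v}d_{v,u}>\ell_{u,v}$ for every edge between nodes. Semigroup condition: for each node $v$ and edge $e$ at $v$, $d_v\in\sum_{\lambda\in L(v,e)}\mathbb{N}\ell_{v,\lambda}$, $L(v,e)$ the leaves $\lambda$ with $e\subseteq[v,\lambda]$. Variables $z_\lambda$ and standard basis vectors $w_\lambda$ of $\mathbb{R}^n$ are indexed by leaves; $w_u=\sum_\lambda\ell_{u,\lambda}w_\lambda$ for nodes $u$. Fix $\alpha_{v,e,\lambda}\in\mathbb{N}$ with $d_v=\sum_{\lambda\in L(v,e)}\alpha_{v,e,\lambda}\ell_{v,\lambda}$,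 $z^{m_{v,e}}=\prod z_\lambda^{\alpha_{v,e,\lambda}}$, $m_{v,e}=\sum\alpha_{v,e,\lambda}w_\lambda$. A splice type system is a family $F_{v,i}=f_{v,i}+g_{v,i}\in\mathcal{O}:=\mathbb{C}\{z_\lambda\}$ ($v$ node, $1\le i\le\delta_v-2$), $f_{v,i}=\sum_{e\ni v}c_{v,e,i}z^{m_{v,e}}$ with all maximal minors of $(c_{v,e,i})_{e,i}$ nonzero, $g_{v,i}$ convergent with every exponent $m$ satisfying $w_v\cdot m>d_v$ and $w_u\cdot m>\ell_{u,v}$ for nodes $u\ne v$. For $w\in\mathbb{R}^n_{\ge0}$, $\mathrm{in}_w(f)$ is the sum of terms of minimal $w$-weight and $\mathrm{in}_w(I)$ the ideal of $\mathcal{O}$ generated by all $\mathrm{in}_w(f)$, $f\in I$. $\mathrm{Trop}^+\mathcal{S}(\Gamma)$ is the set of $w\in\mathbb{R}_{>0}^n$ such that $\mathrm{in}_w(I)$ contains no monomial, $I$ the ideal generated by $\mathcal{S}(\Gamma)$. $\rho:\Gamma\to\mathbb{R}^n$ sends each vertex $u$ to $w_u/|w_u|$ ($1$-norm), affinely on edges. A subtree $T$ is a connected subgraph of $\Gamma$; its leaves are its vertices of valency $\le1$ in $T$, its nodes the others; $T$ is star-full if all edges of $\Gamma$ adjacent to each node of $T$ belong to $T$. *)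

theory Defs
  imports "HOL-Analysis.Analysis" "Jordan_Normal_Form.Determinant"
begin

definition valency :: "'v set set \<Rightarrow> 'v \<Rightarrow> nat" where
  "valency E v = card {e \<in> E. v \<in> e}"

definition is_walk :: "'v set set \<Rightarrow> 'v list \<Rightarrow> bool" where
  "is_walk E p \<longleftrightarrow> p \<noteq> [] \<and> (\<forall>i. Suc i < length p \<longrightarrow> {p ! i, p ! Suc i} \<in> E)"

definition connected_graph :: "'v set \<Rightarrow> 'v set set \<Rightarrow> bool" where
  "connected_graph V E \<longleftrightarrow> V \<noteq> {} \<and>
     (\<forall>u\<in>V. \<forall>v\<in>V. \<exists>p. is_walk E p \<and> set p \<subseteq> V \<and> hd p = u \<and> last p = v)"

definition graph :: "'v set \<Rightarrow> 'v set set \<Rightarrow> bool" where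
  "graph V E \<longleftrightarrow> finite V \<and> (\<forall>e\<in>E. \<exists>a b. a \<noteq> b \<and> a \<in> V \<and> b \<in> V \<and> e = {a, b})"

definition is_tree :: "'v set \<Rightarrow> 'v set set \<Rightarrow> bool" where
  "is_tree V E \<longleftrightarrow> graph V E \<and> connected_graph V E \<and> card E + 1 = card V"

definition simple_path :: "'v set set \<Rightarrow> 'v \<Rightarrow> 'v \<Rightarrow> 'v list \<Rightarrow> bool" where
  "simple_path E u v p \<longleftrightarrow> is_walk E p \<and> distinct p \<and> hd p = u \<and> last p = v"

definition geod_verts :: "'v set set \<Rightarrow> 'v \<Rightarrow> 'v \<Rightarrow> 'v set" where
  "geod_verts E u v = {w. \<exists>p. simple_path E u v p \<and> w \<in> set p}"

definition geod_edges :: "'v set set \<Rightarrow> 'v \<Rightarrow> 'v \<Rightarrow> 'v set set" where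
  "geod_edges E u v = {e. \<exists>p i. simple_path E u v p \<and> Suc i < length p \<and> e = {p ! i, p ! Suc i}}"

definition leaves :: "'v set \<Rightarrow> 'v set set \<Rightarrow> 'v set" where
  "leaves V E = {v \<in> V. valency E v = 1}"

definition nodes :: "'v set \<Rightarrow> 'v set set \<Rightarrow> 'v set" where
  "nodes V E = {v \<in> V. valency E v \<noteq> 1}"

text \<open>Weights: d v e is the weight d_{v,e} at the node v of the edge e at v.\<close>
definition splice_diagram :: "'v set \<Rightarrow> 'v set set \<Rightarrow> ('v \<Rightarrow> 'v set \<Rightarrow> nat) \<Rightarrow> bool" where
  "splice_diagram V E d \<longleftrightarrow> is_tree V E \<and> (\<exists>v\<in>V. valency E v \<ge> 3) \<and>
     (\<forall>v\<in>V. valency E v \<noteq> 2) \<and>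
     (\<forall>v\<in>nodes V E. \<forall>e\<in>E. v \<in> e \<longrightarrow> d v e > 0)"

definition dv :: "'v set set \<Rightarrow> ('v \<Rightarrow> 'v set \<Rightarrow> nat) \<Rightarrow> 'v \<Rightarrow> nat" where
  "dv E d v = (\<Prod>e\<in>{e \<in> E. v \<in> e}. d v e)"

definition dvu :: "'v set set \<Rightarrow> ('v \<Rightarrow> 'v set \<Rightarrow> nat) \<Rightarrow> 'v \<Rightarrow> 'v \<Rightarrow> nat" where
  "dvu E d v u = d v (THE e. e \<in> E \<and> v \<in> e \<and> e \<in> geod_edges E v u)"

definition ell :: "'v set \<Rightarrow> 'v set set \<Rightarrow> ('v \<Rightarrow> 'v set \<Rightarrow> nat) \<Rightarrow> 'v \<Rightarrow> 'v \<Rightarrow> nat" where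
  "ell V E d u v = (if u = v then dv E d v else
     (\<Prod>w\<in>nodes V E \<inter> geod_verts E u v.
        \<Prod>e\<in>{e \<in> E. w \<in> e \<and> e \<notin> geod_edges E u v}. d w e))"

definition edge_determinant_condition :: "'v set \<Rightarrow> 'v set set \<Rightarrow> ('v \<Rightarrow> 'v set \<Rightarrow> nat) \<Rightarrow> bool" where
  "edge_determinant_condition V E d \<longleftrightarrow>
     (\<forall>u\<in>nodes V E. \<forall>v\<in>nodes V E. {u, v} \<in> E \<longrightarrow> dvu E d u v * dvu E d v u > ell V E d u v)"

definition Lve :: "'v set \<Rightarrow> 'v set set \<Rightarrow> 'v \<Rightarrow> 'v set \<Rightarrow> 'v set" where
  "Lve V E v e = {l \<in> leaves V E. e \<in> geod_edges E v l}"

definition semigroup_condition :: "'v set \<Rightarrow> 'v set set \<Rightarrow> ('v \<Rightarrow> 'v set \<Rightarrow> nat) \<Rightarrow> bool" where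
  "semigroup_condition V E d \<longleftrightarrow>
     (\<forall>v\<in>nodes V E. \<forall>e\<in>E. v \<in> e \<longrightarrow>
        (\<exists>a :: 'v \<Rightarrow> nat. dv E d v = (\<Sum>l\<in>Lve V E v e. a l * ell V E d v l)))"

definition admissible_alpha :: "'v set \<Rightarrow> 'v set set \<Rightarrow> ('v \<Rightarrow> 'v set \<Rightarrow> nat)
    \<Rightarrow> ('v \<Rightarrow> 'v set \<Rightarrow> 'v \<Rightarrow> nat) \<Rightarrow> bool" where
  "admissible_alpha V E d \<alpha> \<longleftrightarrow>
     (\<forall>v\<in>nodes V E. \<forall>e\<in>E. v \<in> e \<longrightarrow>
        (\<forall>l. l \<notin> Lve V E v e \<longrightarrow> \<alpha> v e l = 0) \<and>
        dv E d v = (\<Sum>l\<in>Lve V E v e. \<alpha> v e l * ell V E d v l))"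

text \<open>A power series is its coefficient function on exponent vectors (functions
  from vertices to nat, supported on the leaves).\<close>
type_synonym 'v pseries = "('v \<Rightarrow> nat) \<Rightarrow> complex"

definition supp_in :: "'v set \<Rightarrow> ('v \<Rightarrow> nat) \<Rightarrow> bool" where
  "supp_in L m \<longleftrightarrow> (\<forall>x. m x \<noteq> 0 \<longrightarrow> x \<in> L)"

definition conv_series :: "'v set \<Rightarrow> 'v pseries set" where
  "conv_series L = {f. (\<forall>m. f m \<noteq> 0 \<longrightarrow> supp_in L m) \<and>
      (\<exists>r::real. r > 0 \<and> (\<lambda>m. norm (f m) * r ^ (\<Sum>x\<in>L. m x)) summable_on UNIV)}"

definition ps_mult :: "'v pseries \<Rightarrow> 'v pseries \<Rightarrow> 'v pseries" where
  "ps_mult f g m = (\<Sum>a\<in>{a. \<forall>x. a x \<le> m x}. f a * g (\<lambda>x. m x - a x))"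

definition monomial :: "('v \<Rightarrow> nat) \<Rightarrow> complex \<Rightarrow> 'v pseries" where
  "monomial m c = (\<lambda>m'. if m' = m then c else 0)"

definition ideal_gen :: "'v set \<Rightarrow> 'v pseries set \<Rightarrow> 'v pseries set" where
  "ideal_gen L S = {f. \<exists>(k::nat) a s. (\<forall>i<k. a i \<in> conv_series L \<and> s i \<in> S) \<and>
       f = (\<lambda>m. \<Sum>i<k. ps_mult (a i) (s i) m)}"

definition wt :: "'v set \<Rightarrow> ('v \<Rightarrow> real) \<Rightarrow> ('v \<Rightarrow> nat) \<Rightarrow> real" where
  "wt L w m = (\<Sum>x\<in>L. w x * real (m x))"

definition init_form :: "'v set \<Rightarrow> ('v \<Rightarrow> real) \<Rightarrow> 'v pseries \<Rightarrow> 'v pseries" where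
  "init_form L w f = (\<lambda>m. if f m \<noteq> 0 \<and> (\<forall>m'. f m' \<noteq> 0 \<longrightarrow> wt L w m \<le> wt L w m')
                          then f m else 0)"

definition init_ideal :: "'v set \<Rightarrow> ('v \<Rightarrow> real) \<Rightarrow> 'v pseries set \<Rightarrow> 'v pseries set" where
  "init_ideal L w I = ideal_gen L (init_form L w ` I)"

definition edges_at :: "'v set set \<Rightarrow> 'v \<Rightarrow> 'v set set" where
  "edges_at E v = {e \<in> E. v \<in> e}"

definition wdot :: "'v set \<Rightarrow> 'v set set \<Rightarrow> ('v \<Rightarrow> 'v set \<Rightarrow> nat) \<Rightarrow> 'v \<Rightarrow> ('v \<Rightarrow> nat) \<Rightarrow> nat" where
  "wdot V E d u m = (\<Sum>l\<in>leaves V E. ell V E d u l * m l)"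

text \<open>All maximal minors of the (delta_v x (delta_v - 2)) matrix (c_{v,e,i}) are nonzero;
  a maximal minor is the determinant of the square submatrix on a set S of
  delta_v - 2 rows (edges), listed in an arbitrary order.\<close>
definition maximal_minors_nonzero :: "'v set set \<Rightarrow> 'v \<Rightarrow> ('v set \<Rightarrow> nat \<Rightarrow> complex) \<Rightarrow> bool" where
  "maximal_minors_nonzero E v c \<longleftrightarrow>
     (\<forall>S enum. S \<subseteq> edges_at E v \<and> card S = valency E v - 2 \<and>
        bij_betw enum {..<valency E v - 2} S \<longrightarrow>
        det (mat (valency E v - 2) (valency E v - 2) (\<lambda>(j, i). c (enum j) (Suc i))) \<noteq> 0)"

definition splice_type_system :: "'v set \<Rightarrow> 'v set set \<Rightarrow> ('v \<Rightarrow> 'v set \<Rightarrow> nat)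
    \<Rightarrow> ('v \<Rightarrow> 'v set \<Rightarrow> 'v \<Rightarrow> nat) \<Rightarrow> ('v \<Rightarrow> nat \<Rightarrow> 'v pseries) \<Rightarrow> bool" where
  "splice_type_system V E d \<alpha> F \<longleftrightarrow>
     (\<forall>v\<in>nodes V E. \<exists>c :: 'v set \<Rightarrow> nat \<Rightarrow> complex. maximal_minors_nonzero E v c \<and>
        (\<forall>i\<in>{1..valency E v - 2}. \<exists>g. g \<in> conv_series (leaves V E) \<and>
           (\<forall>m. g m \<noteq> 0 \<longrightarrow> wdot V E d v m > dv E d v \<and>
                (\<forall>u\<in>nodes V E. u \<noteq> v \<longrightarrow> wdot V E d u m > ell V E d u v)) \<and>
           F v i = (\<lambda>m. (\<Sum>e\<in>edges_at E v. c e i * monomial (\<alpha> v e) 1 m) + g m)))"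

definition splice_ideal :: "'v set \<Rightarrow> 'v set set \<Rightarrow> ('v \<Rightarrow> nat \<Rightarrow> 'v pseries) \<Rightarrow> 'v pseries set" where
  "splice_ideal V E F = ideal_gen (leaves V E)
      {F v i | v i. v \<in> nodes V E \<and> i \<in> {1..valency E v - 2}}"

text \<open>Positive tropicalization: vectors of R^n (coordinates indexed by leaves,
  represented as functions vanishing off the leaves) with positive coordinates
  whose initial ideal contains no monomial.\<close>
definition trop_pos :: "'v set \<Rightarrow> 'v set set \<Rightarrow> ('v \<Rightarrow> nat \<Rightarrow> 'v pseries) \<Rightarrow> ('v \<Rightarrow> real) set" where
  "trop_pos V E F = {w. (\<forall>x\<in>leaves V E. w x > 0) \<and> (\<forall>x. x \<notin> leaves V E \<longrightarrow> w x = 0) \<and>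
      \<not> (\<exists>m c. c \<noteq> 0 \<and> supp_in (leaves V E) m \<and>
           monomial m c \<in> init_ideal (leaves V E) w (splice_ideal V E F))}"

definition wvec :: "'v set \<Rightarrow> 'v set set \<Rightarrow> ('v \<Rightarrow> 'v set \<Rightarrow> nat) \<Rightarrow> 'v \<Rightarrow> 'v \<Rightarrow> real" where
  "wvec V E d u = (if u \<in> leaves V E then (\<lambda>x. if x = u then 1 else 0)
                   else (\<lambda>x. if x \<in> leaves V E then real (ell V E d u x) else 0))"

definition rho :: "'v set \<Rightarrow> 'v set set \<Rightarrow> ('v \<Rightarrow> 'v set \<Rightarrow> nat) \<Rightarrow> 'v \<Rightarrow> 'v \<Rightarrow> real" where
  "rho V E d u = (let n1 = (\<Sum>x\<in>leaves V E. \<bar>wvec V E d u x\<bar>) in (\<lambda>x. wvec V E d u x / n1))"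

definition fseg :: "('v \<Rightarrow> real) \<Rightarrow> ('v \<Rightarrow> real) \<Rightarrow> ('v \<Rightarrow> real) set" where
  "fseg a b = {(\<lambda>x. (1 - t) * a x + t * b x) | t. 0 \<le> t \<and> t \<le> 1}"

text \<open>Image rho(T) of the subtree (VT, ET): rho is affine on each edge.\<close>
definition rho_image :: "'v set \<Rightarrow> 'v set set \<Rightarrow> ('v \<Rightarrow> 'v set \<Rightarrow> nat)
    \<Rightarrow> 'v set \<Rightarrow> 'v set set \<Rightarrow> ('v \<Rightarrow> real) set" where
  "rho_image V E d VT ET = rho V E d ` VT \<union>
      (\<Union>{fseg (rho V E d a) (rho V E d b) | a b. {a, b} \<in> ET})"

definition conv_rho :: "'v set \<Rightarrow> 'v set set \<Rightarrow> ('v \<Rightarrow> 'v set \<Rightarrow> nat) \<Rightarrow> 'v set \<Rightarrow> ('v \<Rightarrow> real) set" where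
  "conv_rho V E d P = {(\<lambda>x. \<Sum>u\<in>P. t u * rho V E d u x) | t.
       (\<forall>u\<in>P. t u \<ge> 0) \<and> (\<Sum>u\<in>P. t u) = 1}"

definition subtree :: "'v set \<Rightarrow> 'v set set \<Rightarrow> 'v set \<Rightarrow> 'v set set \<Rightarrow> bool" where
  "subtree V E VT ET \<longleftrightarrow> VT \<subseteq> V \<and> ET \<subseteq> E \<and> (\<forall>e\<in>ET. e \<subseteq> VT) \<and> connected_graph VT ET"

definition subtree_leaves :: "'v set \<Rightarrow> 'v set set \<Rightarrow> 'v set" where
  "subtree_leaves VT ET = {v \<in> VT. valency ET v \<le> 1}"

definition subtree_nodes :: "'v set \<Rightarrow> 'v set set \<Rightarrow> 'v set" where
  "subtree_nodes VT ET = {v \<in> VT. valency ET v > 1}"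

definition star_full :: "'v set set \<Rightarrow> 'v set \<Rightarrow> 'v set set \<Rightarrow> bool" where
  "star_full E VT ET \<longleftrightarrow> (\<forall>v\<in>subtree_nodes VT ET. \<forall>e\<in>E. v \<in> e \<longrightarrow> e \<in> ET)"

end

theory Submission
  imports Defs
begin

text \<open>
  Write a weight vector in the convex hull as \<open>w = \<Sum> s\<^sub>u w\<^sub>u\<close> with \<open>s \<ge> 0\<close>. The edge determinant
  condition gives \<open>w\<^sub>u \<cdot> m\<^bsub>v,e\<^esub> \<ge> \<ell>\<^bsub>u,v\<^esub>\<close> for nodes \<open>u\<close>, strictly iff \<open>e\<close> points towards \<open>u\<close>. Hence,
  at a node \<open>v\<close> of the subtree, the monomials of minimal weight are those of the branches at \<open>v\<close>
  that do not meet the support of \<open>s\<close>, provided that there is such a branch. By the condition on minors, the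
  initial ideal then contains a monomial unless at most one branch meets the support.
  Since \<open>w\<^sub>v\<close> is a nonnegative combination of the \<open>w\<^sub>u\<close>, \<open>u\<close> a leaf of the subtree, one can subtract a
  multiple of \<open>w\<^sub>v\<close> from \<open>w\<close> so that some leaf leaves the support. At the neighbour of this leaf only one
  branch remains supported, so \<open>w\<close> lives on that branch and induction on the size of the subtree applies.
\<close>

section \<open>Branches and geodesics in finite trees\<close>

text \<open>The subtraction decides the argument: if every branch at a node meets the support, all
  edge monomials there may exceed the common lower bound, and the equations at that node say
  nothing. Emptying a boundary leaf \<open>u0\<close> makes its branch at the neighbouring vertex
  attain the bound. The exchange is possible because the coefficients of \<open>w\<close> are not
  unique. Its price is new support at an inner vertex, so the induction has to allow one extra
  supported vertex from the start. The edge determinant condition enters twice: it gives the strict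
  inequality for linking numbers inside a branch, and the positive coefficient that arises when the
  vectors of two adjacent vertices are compared. Everything takes place in cones; vectors are
  normalised only at the end.\<close>

lemma is_walk_single [simp]: "is_walk E [a]"
  by (simp add: is_walk_def)

lemma is_walk_Cons2 [simp]: "is_walk E (a # b # p) \<longleftrightarrow> {a, b} \<in> E \<and> is_walk E (b # p)"
  by (auto simp: is_walk_def nth_Cons split: nat.splits)

lemma simple_path_single [simp]: "simple_path E u x [a] \<longleftrightarrow> a = u \<and> x = a"
  by (auto simp: simple_path_def)

lemma simple_path_Cons2:
  "simple_path E u x (a # b # p) \<longleftrightarrow>
     a = u \<and> {u, b} \<in> E \<and> u \<notin> set (b # p) \<and> simple_path E b x (b # p)"
  by (auto simp: simple_path_def)

lemma simple_pathD:
  assumes "simple_path E u x p"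
  shows "\<exists>q. p = u # q" "u \<in> set p" "x \<in> set p" "distinct p" "is_walk E p"
  using assms by (cases p; auto simp: simple_path_def is_walk_def)+

lemma is_walk_suffix: "is_walk E (p @ a # q) \<Longrightarrow> is_walk E (a # q)"
proof (induction p)
  case (Cons b p) then show ?case by (cases p) auto
qed simp

lemma is_walk_prefix: "is_walk E (p @ a # q) \<Longrightarrow> is_walk E (p @ [a])"
proof (induction p)
  case (Cons b p) then show ?case by (cases p) auto
qed simp

lemma simple_path_suffix:
  assumes "simple_path E u x p" "a \<in> set p"
  obtains q where "simple_path E a x q" "set q \<subseteq> set p"
proof -
  obtain p1 p2 where p: "p = p1 @ a # p2" using assms(2) by (meson split_list)
  have "simple_path E a x (a # p2)"
    using assms(1) is_walk_suffix unfolding p simple_path_def by auto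
  then show thesis using that p by fastforce
qed

text \<open>The form \<open>u # hd q # q'\<close> records that the prefix leaves \<open>u\<close>
  along the same edge as the whole path; this edge decides in which branch \<open>a\<close>
  lies.\<close>

lemma simple_path_prefix:
  assumes "simple_path E u x (u # q)" "a \<in> set q"
  obtains q' where "simple_path E u a (u # hd q # q')"
proof -
  obtain p1 p2 where p: "q = p1 @ a # p2" using assms(2) by (meson split_list)
  have "is_walk E ((u # p1) @ [a])"
    using assms(1) is_walk_prefix[of E "u # p1" a p2] unfolding p simple_path_def by auto
  then have "simple_path E u a (u # p1 @ [a])"
    using assms(1) unfolding p simple_path_def by auto
  then show thesis using that[of "tl (p1 @ [a])"] p by (cases p1) auto
qed

lemma is_walk_stays:
  assumes "is_walk E p" "p \<noteq> []" "hd p \<in> A" "last p \<notin> A"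
  shows "\<exists>a b. a \<in> set p \<and> b \<in> set p \<and> a \<in> A \<and> b \<notin> A \<and> {a, b} \<in> E"
  using assms
proof (induction p rule: induct_list012)
  case (3 a b p)
  show ?case
  proof (cases "b \<in> A")
    case True
    then obtain a' b' where "a' \<in> set (b # p)" "b' \<in> set (b # p)" "a' \<in> A" "b' \<notin> A" "{a', b'} \<in> E"
      using "3.IH"(2) "3.prems" by auto
    then show ?thesis by (meson list.set_intros(2))
  next
    case False
    then show ?thesis using "3.prems" by (intro exI[of _ a] exI[of _ b]) auto
  qed
qed auto

locale finite_tree =
  fixes V :: "'v set" and E :: "'v set set"
  assumes tree: "is_tree V E"
begin

lemma finite_V: "finite V"
  using tree by (simp add: is_tree_def graph_def)

lemma edge_V:
  assumes "{a, b} \<in> E" shows "a \<in> V" "b \<in> V" "a \<noteq> b"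
  using assms tree by (auto simp: is_tree_def graph_def doubleton_eq_iff dest!: bspec)

lemma finite_E: "finite E"
proof -
  have "E \<subseteq> Pow V" using tree by (auto simp: is_tree_def graph_def)
  then show ?thesis using finite_V finite_subset by auto
qed

lemma edge_at_obtain:
  assumes "e \<in> E" "v \<in> e" obtains y where "e = {v, y}" "{v, y} \<in> E"
proof -
  obtain a b where "e = {a, b}" using assms(1) tree by (auto simp: is_tree_def graph_def)
  with assms that show thesis by (metis insert_commute insert_iff singletonD)
qed

section \<open>Rooting the tree; every edge is a bridge\<close>

definition adj :: "('v \<times> 'v) set" where "adj = {(a, b). {a, b} \<in> E}"

lemma walk_rtrancl: "is_walk E p \<Longrightarrow> (hd p, last p) \<in> adj\<^sup>*"
proof (induction p rule: induct_list012)
  case (3 a b p)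
  then have "(a, b) \<in> adj" "(b, last (b # p)) \<in> adj\<^sup>*" by (auto simp: adj_def)
  then show ?case by (simp add: converse_rtrancl_into_rtrancl)
qed (auto simp: is_walk_def)

lemma connected: "u \<in> V \<Longrightarrow> v \<in> V \<Longrightarrow> (u, v) \<in> adj\<^sup>*"
  using tree walk_rtrancl unfolding is_tree_def connected_graph_def by metis

text \<open>A spanning tree of shortest walks to a root already has \<^term>\<open>card V - 1\<close> edges, so it is
  the whole graph; this makes every edge a bridge.\<close>

lemma rooted:
  obtains r and dep :: "'v \<Rightarrow> nat" and par where "r \<in> V"
    "\<And>v. v \<in> V \<Longrightarrow> v \<noteq> r \<Longrightarrow> dep v = Suc (dep (par v))" "par r = r"
    "\<And>v. v \<in> V \<Longrightarrow> par v \<in> V"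
    "\<And>a b. {a, b} \<in> E \<Longrightarrow> (b \<noteq> r \<and> par b = a) \<or> (a \<noteq> r \<and> par a = b)"
proof -
  obtain r where r: "r \<in> V" using tree by (auto simp: is_tree_def connected_graph_def)
  define dep where "dep v = (LEAST n. (r, v) \<in> adj ^^ n)" for v
  have dep: "(r, v) \<in> adj ^^ dep v" if "v \<in> V" for v
    unfolding dep_def by (rule LeastI_ex) (use connected[OF r that] rtrancl_power in blast)
  have ex: "\<exists>y. {v, y} \<in> E \<and> dep v = Suc (dep y)" if v: "v \<in> V" "v \<noteq> r" for v
  proof -
    have "dep v \<noteq> 0" using dep[OF v(1)] v(2) by (metis relpow_0_E)
    then obtain n where n: "dep v = Suc n" by (cases "dep v") auto
    obtain y where y: "(r, y) \<in> adj ^^ n" "(y, v) \<in> adj" using dep[OF v(1)] unfolding n by auto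
    have yV: "y \<in> V" "{v, y} \<in> E" using y(2) edge_V by (auto simp: adj_def insert_commute)
    have "(r, v) \<in> adj ^^ Suc (dep y)" using dep[OF yV(1)] y(2) by auto
    then have "dep v \<le> Suc (dep y)" unfolding dep_def[of v] by (rule Least_le)
    moreover have "dep y \<le> n" unfolding dep_def[of y] using y(1) by (rule Least_le)
    ultimately show ?thesis using n yV by auto
  qed
  define par where "par v = (if v = r then r else SOME y. {v, y} \<in> E \<and> dep v = Suc (dep y))" for v
  have par: "{v, par v} \<in> E" "dep v = Suc (dep (par v))" if v: "v \<in> V" "v \<noteq> r" for v
    using someI_ex[OF ex[OF v]] v(2) by (auto simp: par_def)
  let ?f = "\<lambda>v. {v, par v}"
  have "inj_on ?f (V - {r})"
  proof (rule inj_onI)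
    fix x y assume "x \<in> V - {r}" "y \<in> V - {r}" "{x, par x} = {y, par y}"
    then show "x = y" using par(2)[of x] par(2)[of y] by (auto simp: doubleton_eq_iff)
  qed
  then have "card (?f ` (V - {r})) = card V - 1"
    using r finite_V by (simp add: card_image)
  also have "\<dots> = card E" using tree unfolding is_tree_def by linarith
  finally have f: "?f ` (V - {r}) = E"
    using par(1) finite_E by (intro card_subset_eq) auto
  have ed: "(b \<noteq> r \<and> par b = a) \<or> (a \<noteq> r \<and> par a = b)" if "{a, b} \<in> E" for a b
  proof -
    have "{a, b} \<in> ?f ` (V - {r})" using that f by simp
    then obtain x where "x \<in> V - {r}" "{a, b} = {x, par x}" by blast
    then show ?thesis by (auto simp: doubleton_eq_iff)
  qed
  have pV: "par v \<in> V" if "v \<in> V" for v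
    using par(1)[OF that] edge_V r by (cases "v = r") (auto simp: par_def)
  have "par r = r" by (simp add: par_def)
  from that[of r dep par, OF r par(2) this pV ed] show thesis .
qed

text \<open>Root the tree. If \<open>v\<close> is the parent of \<open>y\<close>, the descendants of
  \<open>y\<close> form the required side, since every edge joins a vertex to its parent. Otherwise
  \<open>y\<close> is the parent of \<open>v\<close>, and the complement of the descendants of
  \<open>v\<close> works.\<close>

lemma bridge:
  assumes "{v, y} \<in> E"
  obtains A where "y \<in> A" "v \<notin> A" "\<And>a b. {a, b} \<in> E \<Longrightarrow> a \<in> A \<Longrightarrow> b \<notin> A \<Longrightarrow> a = y \<and> b = v"
proof (rule rooted)
  fix r and dep :: "'v \<Rightarrow> nat" and par
  assume r: "r \<in> V"
    and dep: "\<And>v. v \<in> V \<Longrightarrow> v \<noteq> r \<Longrightarrow> dep v = Suc (dep (par v))" and pr: "par r = r"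
    and pV: "\<And>v. v \<in> V \<Longrightarrow> par v \<in> V"
    and ed: "\<And>a b. {a, b} \<in> E \<Longrightarrow> (b \<noteq> r \<and> par b = a) \<or> (a \<noteq> r \<and> par a = b)"
  \<comment> \<open>Depth does not grow along parents, so a vertex cannot descend from its own
    child.\<close>
  have up: "dep ((par ^^ k) x) \<le> dep x" if "x \<in> V" for k x
    using that
  proof (induction k arbitrary: x)
    case (Suc k)
    show ?case
    proof (cases "x = r")
      case True then show ?thesis using Suc.IH[of x] Suc.prems pr by (simp add: funpow_swap1)
    next
      case False
      then show ?thesis using Suc.IH[OF pV[OF Suc.prems]] dep[OF Suc.prems False] by (simp add: funpow_swap1)
    qed
  qed simp
  have down: "\<exists>A. y \<in> A \<and> v \<notin> A \<and> (\<forall>a b. {a, b} \<in> E \<longrightarrow> a \<in> A \<longrightarrow> b \<notin> A \<longrightarrow> a = y \<and> b = v)"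
    if vy: "{v, y} \<in> E" "y \<noteq> r" "par y = v" for v y
  proof -
    define A where "A = {x. \<exists>k. (par ^^ k) x = y}"
    have V: "v \<in> V" "y \<in> V" using edge_V vy(1) by auto
    have A_par: "x \<in> A" if px: "par x \<in> A" for x
    proof -
      obtain k where "(par ^^ k) (par x) = y" using px by (auto simp: A_def)
      then have "(par ^^ Suc k) x = y" by (simp add: funpow_swap1)
      then show ?thesis unfolding A_def by blast
    qed
    have "(par ^^ 0) y = y" by simp
    then have "y \<in> A" unfolding A_def by blast
    moreover have "v \<notin> A"
    proof
      assume "v \<in> A"
      then obtain k where "(par ^^ k) v = y" by (auto simp: A_def)
      then show False using up[OF V(1), of k] dep[OF V(2) vy(2)] vy(3) by simp
    qed
    moreover have "a = y \<and> b = v" if ab: "{a, b} \<in> E" "a \<in> A" "b \<notin> A" for a b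
    proof -
      have b: "par a = b" using ed[OF ab(1)] A_par ab(2,3) by blast
      obtain k where k: "(par ^^ k) a = y" using ab(2) by (auto simp: A_def)
      show ?thesis
      proof (cases k)
        case 0 then show ?thesis using k b vy by simp
      next
        case (Suc k')
        then have "(par ^^ k') b = y" using k b by (simp add: funpow_swap1)
        then show ?thesis using ab(3) by (auto simp: A_def)
      qed
    qed
    ultimately show ?thesis by blast
  qed
  show thesis
  proof (cases "y \<noteq> r \<and> par y = v")
    case True then show thesis using down assms that by metis
  next
    case False
    then have "{y, v} \<in> E" "v \<noteq> r" "par v = y" using ed[OF assms] assms by (auto simp: insert_commute)
    from down[OF this] obtain A where A: "v \<in> A" "y \<notin> A"
      "\<forall>a b. {a, b} \<in> E \<longrightarrow> a \<in> A \<longrightarrow> b \<notin> A \<longrightarrow> a = v \<and> b = y" by blast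
    show thesis
    proof (rule that[of "- A"])
      fix a b assume ab: "{a, b} \<in> E" "a \<in> - A" "b \<notin> - A"
      then have "{b, a} \<in> E" by (simp add: insert_commute)
      then show "a = y \<and> b = v" using ab A(3) by blast
    qed (use A in auto)
  qed
qed

lemma simple_path_ex:
  assumes "u \<in> V" "x \<in> V" obtains p where "simple_path E u x p"
proof -
  have "\<exists>p. simple_path E u x p" using connected[OF assms]
  proof (induction rule: converse_rtrancl_induct)
    case base show ?case by (rule exI[of _ "[x]"]) simp
  next
    case (step a b)
    then obtain p where p: "simple_path E b x p" by blast
    show ?case
    proof (cases "a \<in> set p")
      case True then show ?thesis using simple_path_suffix[OF p] by metis
    next
      case False
      obtain q where "p = b # q" using simple_pathD(1)[OF p] by blast
      then have "simple_path E a x (a # p)"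
        using p False step(1) by (simp add: simple_path_Cons2 adj_def)
      then show ?thesis by blast
    qed
  qed
  then show thesis using that by blast
qed

lemma simple_path_V:
  assumes "simple_path E u x p" "u \<in> V" shows "set p \<subseteq> V"
  using assms
proof (induction p arbitrary: u rule: induct_list012)
  case (3 a b p)
  then show ?case using edge_V[of u b] by (auto simp: simple_path_Cons2)
qed auto

section \<open>Branches at a vertex\<close>

definition br :: "'v \<Rightarrow> 'v \<Rightarrow> 'v set" where
  "br v y = {x. \<exists>p. simple_path E v x (v # y # p)}"

text \<open>\<open>br v y\<close> is the component of \<open>y\<close> after deletion of the edge to
  \<open>v\<close>. On \<open>V\<close> it agrees with a side \<open>A\<close> of the bridge: a
  simple path from \<open>v\<close> never returns to \<open>v\<close>, so after its first step it
  cannot cross that edge.\<close>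

lemma br_separates:
  assumes "{v, y} \<in> E"
  shows "v \<notin> br v y" "y \<in> br v y" "br v y \<subseteq> V"
    and "\<And>a b. {a, b} \<in> E \<Longrightarrow> a \<in> br v y \<Longrightarrow> b \<notin> br v y \<Longrightarrow> a = y \<and> b = v"
    and "\<And>x z p. simple_path E v x (v # z # p) \<Longrightarrow> x \<in> br v y \<Longrightarrow> z = y"
proof -
  obtain A where A: "y \<in> A" "v \<notin> A" "\<And>a b. {a, b} \<in> E \<Longrightarrow> a \<in> A \<Longrightarrow> b \<notin> A \<Longrightarrow> a = y \<and> b = v"
    using bridge[OF assms] by blast
  have inA: "x \<in> A \<longleftrightarrow> z = y" if p: "simple_path E v x (v # z # p)" for x z p
  proof
    assume z: "z = y"
    show "x \<in> A"
    proof (rule ccontr)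
      assume "x \<notin> A"
      then show False using is_walk_stays[of E "z # p" A] p A z unfolding simple_path_def by auto
    qed
  next
    assume x: "x \<in> A"
    show "z = y"
    proof (rule ccontr)
      assume z: "z \<noteq> y"
      have "{z, v} \<in> E" using p by (simp add: simple_path_Cons2 insert_commute)
      then have "z \<notin> A" using A z by blast
      then show False using is_walk_stays[of E "z # p" "- A"] p A(3) x unfolding simple_path_def
        by (auto simp: insert_commute)
    qed
  qed
  have v: "v \<in> V" using assms edge_V by blast
  have brA: "br v y = A \<inter> V"
  proof
    show "br v y \<subseteq> A \<inter> V"
    proof
      fix x assume "x \<in> br v y"
      then obtain p where p: "simple_path E v x (v # y # p)" by (auto simp: br_def)
      show "x \<in> A \<inter> V" using inA[OF p] simple_path_V[OF p v] simple_pathD(3)[OF p] by auto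
    qed
    show "A \<inter> V \<subseteq> br v y"
    proof
      fix x assume x: "x \<in> A \<inter> V"
      then obtain p where p: "simple_path E v x p" using simple_path_ex[OF v, of x] by blast
      show "x \<in> br v y"
      proof (cases "tl p")
        case Nil
        then have "x = v" using p simple_pathD(1)[OF p] by auto
        then show ?thesis using x A by auto
      next
        case (Cons z q)
        then have "p = v # z # q" using simple_pathD(1)[OF p] by auto
        then show ?thesis using p inA x unfolding br_def by blast
      qed
    qed
  qed
  show "v \<notin> br v y" "y \<in> br v y" "br v y \<subseteq> V" using A assms edge_V brA by auto
  show "\<And>a b. {a, b} \<in> E \<Longrightarrow> a \<in> br v y \<Longrightarrow> b \<notin> br v y \<Longrightarrow> a = y \<and> b = v"
    using A(3) edge_V unfolding brA by blast
  show "\<And>x z p. simple_path E v x (v # z # p) \<Longrightarrow> x \<in> br v y \<Longrightarrow> z = y"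
    using inA brA by blast
qed

lemma br_edge: "x \<in> br v y \<Longrightarrow> {v, y} \<in> E"
  by (auto simp: br_def simple_path_Cons2)

lemma br_V: "x \<in> br v y \<Longrightarrow> x \<in> V"
  using br_separates(3)[OF br_edge] by blast

lemma br_disjoint:
  assumes "x \<in> br v y" "x \<in> br v z" shows "y = z"
proof -
  obtain p where "simple_path E v x (v # z # p)" using assms(2) by (auto simp: br_def)
  from br_separates(5)[OF br_edge[OF assms(1)] this assms(1)] show ?thesis by simp
qed

lemma br_obtain:
  assumes "v \<in> V" "x \<in> V" "x \<noteq> v" obtains y where "x \<in> br v y"
proof -
  obtain p where p: "simple_path E v x p" using simple_path_ex[OF assms(1,2)] by blast
  obtain q where "p = v # q" using simple_pathD(1)[OF p] by blast
  then show thesis using that p assms by (cases q) (auto simp: br_def)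
qed

text \<open>A simple path from \<open>v\<close> that avoids \<open>y\<close> becomes a simple path
  from \<open>y\<close> through \<open>v\<close> when \<open>y\<close> is put in front; one that
  meets \<open>y\<close> has to start with the edge to \<open>y\<close>.\<close>

lemma br_opposite:
  assumes "{v, y} \<in> E" shows "br y v = V - br v y"
proof -
  have yv: "{y, v} \<in> E" using assms by (simp add: insert_commute)
  have "x \<in> br y v" if xV: "x \<in> V" and "x \<notin> br v y" for x
  proof -
    obtain p where p: "simple_path E v x p" using simple_path_ex[OF edge_V(1)[OF assms] xV] by blast
    obtain q where q: "p = v # q" using simple_pathD(1)[OF p] by blast
    have "y \<notin> set p"
    proof
      assume y: "y \<in> set p"
      then have "y \<in> set q" using q edge_V(3)[OF assms] by auto
      then obtain q' where q': "simple_path E v y (v # hd q # q')"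
        using simple_path_prefix[of E v x q y] p q by blast
      have "hd q = y" using br_separates(5)[OF assms q' br_separates(2)[OF assms]] .
      then show False using p q \<open>x \<notin> br v y\<close> \<open>y \<in> set q\<close> by (cases q) (auto simp: br_def)
    qed
    then have "simple_path E y x (y # p)" using p q yv by (simp add: simple_path_Cons2)
    then show ?thesis using q by (auto simp: br_def)
  qed
  moreover have False if x: "x \<in> br v y" "x \<in> br y v" for x
  proof -
    obtain p where p: "simple_path E v x (v # y # p)" using x(1) by (auto simp: br_def)
    then have yp: "simple_path E y x (y # p)" "v \<notin> set (y # p)" by (auto simp: simple_path_Cons2)
    show False
    proof (cases p)
      case Nil
      then show False using x(2) yp br_separates(1)[OF yv] by simp
    next
      case (Cons z q)
      then show False using br_separates(5)[OF yv] x(2) yp by auto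
    qed
  qed
  ultimately show ?thesis using br_separates(3)[OF yv] by blast
qed

text \<open>The recursion behind the inductions on \<open>card (br v y)\<close>.\<close>

lemma br_unfold:
  assumes "{v, y} \<in> E" shows "br v y = insert y (\<Union>z\<in>{z. {y, z} \<in> E \<and> z \<noteq> v}. br y z)"
proof -
  have "{y, v} \<in> E" using assms by (simp add: insert_commute)
  note op = br_opposite[OF this]
  show ?thesis
  proof (intro Set.set_eqI iffI)
    fix x assume x: "x \<in> br v y"
    then have "x \<in> V" "x \<notin> br y v" using op by auto
    show "x \<in> insert y (\<Union>z\<in>{z. {y, z} \<in> E \<and> z \<noteq> v}. br y z)"
    proof (cases "x = y")
      case False
      then obtain z where z: "x \<in> br y z" using br_obtain[of y x] edge_V(2)[OF assms] \<open>x \<in> V\<close> by blast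
      then have "z \<noteq> v" using \<open>x \<notin> br y v\<close> by blast
      then show ?thesis using z br_edge[OF z] by blast
    qed simp
  next
    fix x assume "x \<in> insert y (\<Union>z\<in>{z. {y, z} \<in> E \<and> z \<noteq> v}. br y z)"
    then consider "x = y" | z where "z \<noteq> v" "x \<in> br y z" by blast
    then show "x \<in> br v y"
    proof cases
      case 1 then show ?thesis using br_separates(2)[OF assms] by simp
    next
      case 2
      then have "x \<notin> br y v" using br_disjoint by metis
      then show ?thesis using op br_V[OF 2(2)] br_opposite[OF assms] by blast
    qed
  qed
qed

lemma br_psubset:
  assumes "{v, y} \<in> E" "{y, z} \<in> E" "z \<noteq> v" shows "br y z \<subset> br v y"
  using br_unfold[OF assms(1)] br_separates(1)[OF assms(2)] br_separates(2)[OF assms(1)] assms by blast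

lemma finite_br: "finite (br v y)"
  by (rule finite_subset[OF _ finite_V]) (use br_V in blast)

lemma card_br_less:
  assumes "{v, y} \<in> E" "{y, z} \<in> E" "z \<noteq> v" shows "card (br y z) < card (br v y)"
  by (rule psubset_card_mono[OF finite_br br_psubset[OF assms]])

text \<open>A branch determines the first step of every simple path into it. Geodesics are defined
  by quantifying over all simple paths, so uniqueness turns them into the vertex and edge sets of
  one path.\<close>

lemma simple_path_unique:
  assumes "simple_path E u x p" "simple_path E u x q" shows "p = q"
  using assms
proof (induction p arbitrary: u q)
  case Nil then show ?case by (simp add: simple_path_def is_walk_def)
next
  case (Cons a p)
  have a: "a = u" using simple_pathD(1)[OF Cons.prems(1)] by auto
  obtain q' where q: "q = u # q'" using simple_pathD(1)[OF Cons.prems(2)] by auto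
  show ?case
  proof (cases p)
    case Nil
    then have "x = u" using Cons.prems(1) a by simp
    show ?thesis
    proof (cases q')
      case (Cons b q'')
      then have "simple_path E b x (b # q'')" "u \<notin> set (b # q'')"
        using Cons.prems(2) q by (auto simp: simple_path_Cons2)
      then show ?thesis using simple_pathD(3) \<open>x = u\<close> by metis
    qed (use Nil a q in simp)
  next
    case (Cons y p')
    then have x: "x \<in> br u y" using Cons.prems(1) a by (auto simp: br_def)
    then have "u \<noteq> x" using br_separates(1)[OF br_edge] by metis
    then obtain z q'' where q': "q' = z # q''" using Cons.prems(2) q by (cases q') auto
    have "z = y" using br_separates(5)[OF br_edge[OF x]] x Cons.prems(2) q q' by simp
    then show ?thesis using Cons.IH[of y q'] Cons.prems Cons q q' a by (auto simp: simple_path_Cons2)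
  qed
qed

section \<open>Geodesics along branches\<close>

lemma geod_path:
  assumes "simple_path E u x p"
  shows "geod_verts E u x = set p"
    "geod_edges E u x = {{p ! i, p ! Suc i} | i. Suc i < length p}"
proof -
  have "simple_path E u x q \<longleftrightarrow> q = p" for q using simple_path_unique assms by blast
  then show "geod_verts E u x = set p"
    "geod_edges E u x = {{p ! i, p ! Suc i} | i. Suc i < length p}"
    unfolding geod_verts_def geod_edges_def by auto
qed

lemma geod_refl: "geod_verts E u u = {u}" "geod_edges E u u = {}"
  using geod_path[of u u "[u]"] by auto

lemma geod_step:
  assumes "x \<in> br v y"
  shows "geod_verts E v x = insert v (geod_verts E y x)" "v \<notin> geod_verts E y x"
    "y \<in> geod_verts E y x" "x \<in> geod_verts E y x"
    "geod_edges E v x = insert {v, y} (geod_edges E y x)"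
proof -
  obtain p where p: "simple_path E v x (v # y # p)" using assms by (auto simp: br_def)
  then have yp: "simple_path E y x (y # p)" "v \<notin> set (y # p)" by (auto simp: simple_path_Cons2)
  show "geod_verts E v x = insert v (geod_verts E y x)" "v \<notin> geod_verts E y x"
     "y \<in> geod_verts E y x" "x \<in> geod_verts E y x"
    using geod_path(1)[OF p] geod_path(1)[OF yp(1)] yp simple_pathD(3)[OF yp(1)] by auto
  have "{{(v # y # p) ! i, (v # y # p) ! Suc i} | i. Suc i < length (v # y # p)}
    = insert {v, y} {{(y # p) ! i, (y # p) ! Suc i} | i. Suc i < length (y # p)}" (is "?A = insert _ ?B")
  proof (intro Set.set_eqI iffI)
    fix e assume "e \<in> ?A"
    then obtain i where "e = {(v # y # p) ! i, (v # y # p) ! Suc i}" "Suc i < length (v # y # p)" by blast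
    then show "e \<in> insert {v, y} ?B" by (cases i) auto
  next
    fix e assume "e \<in> insert {v, y} ?B"
    then consider "e = {v, y}" | i where "e = {(y # p) ! i, (y # p) ! Suc i}" "Suc i < length (y # p)" by blast
    then show "e \<in> ?A"
    proof cases
      case 1 then show ?thesis by (auto intro: exI[of _ 0])
    next
      case 2 then show ?thesis by (auto intro!: exI[of _ "Suc i"])
    qed
  qed
  then show "geod_edges E v x = insert {v, y} (geod_edges E y x)"
    using geod_path(2)[OF p] geod_path(2)[OF yp(1)] by simp
qed

lemma geod_edges_subset: "e \<in> geod_edges E u x \<Longrightarrow> e \<subseteq> geod_verts E u x"
  unfolding geod_edges_def geod_verts_def by (force intro: nth_mem)

lemma edge_in_geod_iff:
  assumes "{v, y} \<in> E" "x \<in> V"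
  shows "{v, y} \<in> geod_edges E v x \<longleftrightarrow> x \<in> br v y"
proof (cases "x = v")
  case True then show ?thesis using geod_refl br_separates(1)[OF assms(1)] by simp
next
  case False
  then obtain z where z: "x \<in> br v z" using br_obtain[OF edge_V(1)[OF assms(1)] assms(2)] by blast
  note g = geod_step[OF z]
  have "{v, y} \<notin> geod_edges E z x" using g(2) geod_edges_subset[of "{v, y}" z x] by auto
  moreover have "x \<in> br v y \<longleftrightarrow> z = y" using z br_disjoint by metis
  ultimately show ?thesis using g(5) edge_V(3)[OF assms(1)] by (auto simp: doubleton_eq_iff)
qed

end

section \<open>Linking numbers\<close>

locale splice = finite_tree V E for V :: "'v set" and E +
  fixes d :: "'v \<Rightarrow> 'v set \<Rightarrow> nat" and \<alpha> :: "'v \<Rightarrow> 'v set \<Rightarrow> 'v \<Rightarrow> nat"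
    and F :: "'v \<Rightarrow> nat \<Rightarrow> 'v pseries"
  assumes diagram: "splice_diagram V E d"
    and edge_det: "edge_determinant_condition V E d"
    and alpha: "admissible_alpha V E d \<alpha>"
    and system: "splice_type_system V E d \<alpha> F"
begin

abbreviation "L \<equiv> leaves V E"
abbreviation "N \<equiv> nodes V E"
abbreviation "l \<equiv> ell V E d"

definition nb :: "'v \<Rightarrow> 'v set" where "nb v = {y. {v, y} \<in> E}"

lemma nb_sym: "y \<in> nb v \<longleftrightarrow> v \<in> nb y"
  by (simp add: nb_def insert_commute)

lemma nb_edge [dest]: "y \<in> nb v \<Longrightarrow> {v, y} \<in> E"
  by (simp add: nb_def)

lemma nb_V: "y \<in> nb v \<Longrightarrow> v \<in> V" "y \<in> nb v \<Longrightarrow> y \<in> V" "y \<in> nb v \<Longrightarrow> v \<noteq> y"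
  using edge_V by (auto simp: nb_def)

lemma finite_nb: "finite (nb v)"
  by (rule finite_subset[OF _ finite_V]) (use nb_V in blast)

lemma inj_nb: "inj_on (\<lambda>y. {v, y}) (nb v)"
  by (rule inj_onI) (auto simp: doubleton_eq_iff)

lemma edges_nb: "{e \<in> E. v \<in> e} = (\<lambda>y. {v, y}) ` nb v"
proof (intro Set.set_eqI iffI)
  fix e assume "e \<in> {e \<in> E. v \<in> e}"
  then obtain y where "e = {v, y}" "{v, y} \<in> E" using edge_at_obtain[of e v] by blast
  then show "e \<in> (\<lambda>y. {v, y}) ` nb v" by (auto simp: nb_def)
qed (auto simp: nb_def)

lemma valency_nb: "valency E v = card (nb v)"
  unfolding valency_def edges_nb by (rule card_image[OF inj_nb])

lemma valency_pos: assumes "v \<in> V" shows "valency E v \<noteq> 0"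
proof -
  obtain u where u: "u \<in> V" "valency E u \<ge> 3" using diagram by (auto simp: splice_diagram_def)
  show ?thesis
  proof (cases "v = u")
    case False
    then obtain y where "u \<in> br v y" using br_obtain[OF assms u(1)] by blast
    then have "y \<in> nb v" using br_edge by (auto simp: nb_def)
    then show ?thesis using finite_nb by (auto simp: valency_nb)
  qed (use u in simp)
qed

lemma N_V: "v \<in> N \<Longrightarrow> v \<in> V" and L_V: "v \<in> L \<Longrightarrow> v \<in> V"
  by (auto simp: nodes_def leaves_def)

lemma N_iff: "v \<in> V \<Longrightarrow> v \<in> N \<longleftrightarrow> v \<notin> L"
  by (auto simp: nodes_def leaves_def)

lemma finite_LN: "finite L" "finite N"
  using finite_V by (auto simp: nodes_def leaves_def)

lemma N_card: "v \<in> N \<Longrightarrow> card (nb v) \<ge> 3"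
  using valency_pos[of v] diagram valency_nb[of v] unfolding nodes_def splice_diagram_def by fastforce

lemma L_nb: assumes "v \<in> L" "y \<in> nb v" shows "nb v = {y}"
proof -
  have "card (nb v) = 1" using assms(1) valency_nb[of v] by (simp add: leaves_def)
  then show ?thesis using assms(2) by (metis card_1_singletonE singletonD)
qed

lemma br_leaf: assumes "y \<in> L" "y \<in> nb v" shows "br v y = {y}"
proof -
  have "v \<in> nb y" using assms(2) nb_sym by blast
  then have "nb y = {v}" using L_nb assms by blast
  then have "{z. {y, z} \<in> E \<and> z \<noteq> v} = {}" by (auto simp: nb_def)
  then show ?thesis using br_unfold[of v y] assms(2) nb_edge by auto
qed

lemma br_nb: "x \<in> br v y \<Longrightarrow> y \<in> nb v"
  using br_edge by (simp add: nb_def)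

lemma br_N: assumes "x \<in> br v y" "x \<noteq> y \<or> x \<in> N" shows "y \<in> N"
proof (rule ccontr)
  assume y: "y \<notin> N"
  have "y \<in> nb v" using br_nb assms by blast
  then have "y \<in> L" using y N_iff nb_V(2) by blast
  then show False using br_leaf[of y v] assms y \<open>y \<in> nb v\<close> by auto
qed

lemma d_pos: "v \<in> N \<Longrightarrow> y \<in> nb v \<Longrightarrow> d v {v, y} > 0"
  using diagram unfolding splice_diagram_def by auto

lemma dv_pos: "v \<in> N \<Longrightarrow> dv E d v > 0"
  using diagram unfolding dv_def splice_diagram_def by (auto intro!: prod_pos)

lemma ell_self: "l v v = dv E d v"
  by (simp add: ell_def)

text \<open>For \<open>u = x\<close> the geodesic is a point without edges, so at a node the product
  is already \<open>dv E d u\<close> and the two cases of \<open>ell\<close> merge.\<close>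

lemma ell_prod:
  assumes "u \<noteq> x \<or> u \<in> N"
  shows "l u x = (\<Prod>w\<in>N \<inter> geod_verts E u x.
        \<Prod>e\<in>{e \<in> E. w \<in> e \<and> e \<notin> geod_edges E u x}. d w e)"
  using assms by (auto simp: ell_def geod_refl dv_def)

lemma ell_pos: assumes "u \<in> N" shows "l u x > 0"
proof -
  have "d w e > 0" if "w \<in> N" "e \<in> E" "w \<in> e" for w e
    using that diagram unfolding splice_diagram_def by auto
  then show ?thesis using assms by (subst ell_prod) (auto intro!: prod_pos)
qed

lemma prod_split_edge:
  assumes "y \<in> nb w" "{w, y} \<notin> S"
  shows "(\<Prod>e\<in>{e \<in> E. w \<in> e \<and> e \<notin> S}. d w e) =
    d w {w, y} * (\<Prod>e\<in>{e \<in> E. w \<in> e \<and> e \<notin> insert {w, y} S}. d w e)"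
proof -
  have "{e \<in> E. w \<in> e \<and> e \<notin> insert {w, y} S} = {e \<in> E. w \<in> e \<and> e \<notin> S} - {{w, y}}" by auto
  then show ?thesis using assms finite_E by (subst prod.remove[of _ "{w, y}"]) auto
qed

text \<open>Removing the first edge of a geodesic rescales the linking number by a factor that does not
  depend on the endpoint \<open>x\<close>; every relation between linking numbers below follows from this.\<close>

lemma ell_step:
  assumes v: "v \<in> N" and y: "y \<in> N" and x: "x \<in> br v y"
  shows "l v x * (d v {v, y} * d y {v, y}) = dv E d v * l y x"
proof -
  let ?G = "geod_verts E y x" and ?S = "geod_edges E y x"
  let ?P = "\<lambda>w S. \<Prod>e\<in>{e \<in> E. w \<in> e \<and> e \<notin> S}. d w e"
  note g = geod_step[OF x]
  have vy: "y \<in> nb v" "v \<in> nb y" using br_nb[OF x] nb_sym by auto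
  have S: "e \<in> ?S \<Longrightarrow> v \<notin> e" for e using geod_edges_subset[of e y x] g(2) by auto
  have nx: "v \<noteq> x" using g by auto
  have fin: "finite (N \<inter> ?G)" using finite_LN by auto
  have "l v x = (\<Prod>w\<in>N \<inter> insert v ?G. ?P w (insert {v, y} ?S))"
    using nx by (simp add: ell_prod g(1,5))
  also have "N \<inter> insert v ?G = insert v (N \<inter> ?G)" using v by auto
  also have "(\<Prod>w\<in>insert v (N \<inter> ?G). ?P w (insert {v, y} ?S)) =
     ?P v (insert {v, y} ?S) * (\<Prod>w\<in>N \<inter> ?G. ?P w (insert {v, y} ?S))"
    using fin g(2) by (subst prod.insert) auto
  also have "?P v (insert {v, y} ?S) = ?P v (insert {v, y} {})"
    using S by (intro prod.cong) auto
  also have "(\<Prod>w\<in>N \<inter> ?G. ?P w (insert {v, y} ?S)) =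
     ?P y (insert {v, y} ?S) * (\<Prod>w\<in>N \<inter> ?G - {y}. ?P w ?S)"
  proof -
    have "?P w (insert {v, y} ?S) = ?P w ?S" if "w \<in> N \<inter> ?G - {y}" for w
      using that g(2) by (intro prod.cong) auto
    then show ?thesis using fin g(3) y by (subst prod.remove[of _ y]) auto
  qed
  finally have 1: "l v x = ?P v (insert {v, y} {}) * (?P y (insert {v, y} ?S) * (\<Prod>w\<in>N \<inter> ?G - {y}. ?P w ?S))" .
  have 2: "dv E d v = d v {v, y} * ?P v (insert {v, y} {})"
    using prod_split_edge[of y v "{}"] vy by (simp add: dv_def)
  have "l y x = (\<Prod>w\<in>N \<inter> ?G. ?P w ?S)" using y by (simp add: ell_prod)
  also have "\<dots> = ?P y ?S * (\<Prod>w\<in>N \<inter> ?G - {y}. ?P w ?S)"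
    using fin g(3) y by (subst prod.remove[of _ y]) auto
  also have "?P y ?S = d y {v, y} * ?P y (insert {v, y} ?S)"
    using prod_split_edge[of v y ?S] vy S by (auto simp: insert_commute)
  finally have 3: "l y x = d y {v, y} * ?P y (insert {v, y} ?S) * (\<Prod>w\<in>N \<inter> ?G - {y}. ?P w ?S)" .
  show "l v x * (d v {v, y} * d y {v, y}) = dv E d v * l y x"
    unfolding 1 2 3 by (simp add: algebra_simps)
qed

lemma dvu_nb: assumes "y \<in> nb v" shows "dvu E d v y = d v {v, y}"
proof -
  have "y \<in> br v y" using br_separates(2) assms nb_edge by blast
  from geod_step(5)[OF this] have "geod_edges E v y = {{v, y}}" by (simp add: geod_refl)
  then have "(THE e. e \<in> E \<and> v \<in> e \<and> e \<in> geod_edges E v y) = {v, y}"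
    using assms by (intro the_equality) auto
  then show ?thesis by (simp add: dvu_def)
qed

lemma edge_det_nb:
  assumes "u \<in> N" "v \<in> N" "v \<in> nb u"
  shows "d u {u, v} * d v {u, v} > l u v"
proof -
  have "u \<in> nb v" using assms nb_sym by blast
  then show ?thesis using edge_det assms dvu_nb[of v u] dvu_nb[of u v] nb_edge
    unfolding edge_determinant_condition_def by (metis insert_commute)
qed

text \<open>Nodes other than \<open>v\<close> contribute equally to both sides. At \<open>v\<close>
  in the interior of the path, the left has all weights times those off both geodesic edges, while
  the right omits one of these edges in each factor. Formally, \<open>ell_step\<close> scales
  \<open>l u x\<close> and \<open>l u v\<close> by the same factor, so the identity moves along the
  path.\<close>

lemma ell_mult:
  assumes "simple_path E u x p" "v \<in> set p" "u \<in> N" "v \<in> N"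
  shows "l u x * dv E d v = l u v * l v x"
  using assms
proof (induction p arbitrary: u rule: induct_list012)
  case (2 a) then show ?case by (simp add: ell_self)
next
  case (3 a b p)
  have a: "a = u" using 3 by (simp add: simple_path_Cons2)
  have bx: "simple_path E b x (b # p)" using 3 by (simp add: simple_path_Cons2)
  show ?case
  proof (cases "v = u")
    case False
    then have v: "v \<in> set (b # p)" using 3 a by auto
    have x: "x \<in> br u b" using 3 a by (auto simp: br_def)
    obtain q where "simple_path E u v (u # hd (b # p) # q)"
      using simple_path_prefix[of E u x "b # p" v] 3 v a by blast
    then have vb: "v \<in> br u b" by (auto simp: br_def)
    then have b: "b \<in> N" using br_N 3 by blast
    have IH: "l b x * dv E d v = l b v * l v x"
      using 3 bx v b by blast
    let ?D = "d u {u, b} * d b {u, b}"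
    have D: "?D > 0" using d_pos[of u b] d_pos[of b u] br_nb[OF x] nb_sym 3 b by (auto simp: insert_commute)
    have "(l u x * dv E d v) * ?D = dv E d u * (l b x * dv E d v)"
      using ell_step[OF _ b x] 3 by (simp add: algebra_simps)
    also have "\<dots> = dv E d u * l b v * l v x" using IH by simp
    also have "\<dots> = (l u v * l v x) * ?D"
      using ell_step[OF _ b vb] 3 by (simp add: algebra_simps)
    finally show ?thesis using D by (metis mult_right_cancel not_less_zero)
  qed (simp add: ell_self)
qed (simp add: simple_path_def is_walk_def)

text \<open>The geodesic from \<open>u\<close> can leave the branch only through \<open>v\<close>,
  so \<open>ell_mult\<close> applies.\<close>

lemma ell_outside:
  assumes "u \<in> N" "v \<in> N" "u \<in> br v y" "x \<in> V" "x \<notin> br v y"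
  shows "l u x * dv E d v = l u v * l v x"
proof -
  obtain p where p: "simple_path E u x p" using simple_path_ex[OF N_V assms(4)] assms by blast
  obtain a b where "a \<in> br v y" "b \<notin> br v y" "{a, b} \<in> E" "b \<in> set p"
    using is_walk_stays[of E p "br v y"] p assms unfolding simple_path_def is_walk_def by auto
  then have "v \<in> set p" using br_separates(4)[OF br_edge[OF assms(3)]] by blast
  then show ?thesis using ell_mult[OF p] assms by blast
qed

text \<open>The edge determinant condition spread over the tree. For \<open>u = y\<close> it is that
  condition times positive factors. In general, compare through \<open>y\<close>: there the
  inequality holds weakly, by induction if \<open>u\<close> and \<open>x\<close> share a branch at
  \<open>y\<close> and as an equality otherwise; the edge between \<open>v\<close> and
  \<open>y\<close> supplies the strictness.\<close>

lemma ell_inside: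
  assumes "u \<in> N" "v \<in> N" "u \<in> br v y" "x \<in> br v y"
  shows "l u x * dv E d v > l u v * l v x"
  using assms
proof (induction "card (br v y)" arbitrary: v y rule: less_induct)
  case less
  have y: "y \<in> N" using br_N less by blast
  have vy: "y \<in> nb v" "v \<in> nb y" using br_nb less nb_sym by blast+
  let ?D = "d v {v, y} * d y {v, y}"
  have D: "?D > 0" using d_pos[of v y] d_pos[of y v] vy less y by (auto simp: insert_commute)
  have vb: "v \<in> br y v" using br_separates(2) vy nb_edge by blast
  have adj: "l y v * l v x < l y x * dv E d v"
  proof -
    have "l y v * l v x * ?D = l y v * dv E d v * l y x"
      using ell_step[OF _ y less.prems(4)] less by (simp add: algebra_simps)
    also have "\<dots> < ?D * dv E d v * l y x"
      using edge_det_nb[OF y less.prems(2) vy(2)] dv_pos[OF less.prems(2)] ell_pos[OF y]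
      by (auto simp: insert_commute algebra_simps)
    finally show ?thesis using D by (simp add: algebra_simps)
  qed
  show ?case
  proof (cases "u = y")
    case True then show ?thesis using adj by simp
  next
    case False
    then obtain z where z: "u \<in> br y z" using br_obtain[of y u] N_V y less by blast
    have uv: "u \<notin> br y v" using br_opposite[of v y] vy nb_edge less by auto
    then have zv: "z \<noteq> v" using z by blast
    have dy: "dv E d y > 0" "dv E d v > 0" using dv_pos y less by auto
    have 1: "l u x * dv E d y \<ge> l u y * l y x"
    proof (cases "x \<in> br y z")
      case True
      have "card (br y z) < card (br v y)"
        by (rule card_br_less) (use vy br_nb[OF z] zv in auto)
      from less.hyps[OF this less.prems(1) y z True] show ?thesis by simp
    next
      case False
      then show ?thesis using ell_outside[OF _ y z _ False] less.prems br_V by force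
    qed
    have "v \<in> V" "v \<notin> br y z" using N_V less vb br_disjoint zv by blast+
    then have 2: "l u v * dv E d y = l u y * l y v" using ell_outside[OF _ y z] less by blast
    have "(l u v * l v x) * dv E d y = l u y * (l y v * l v x)" using 2 by (simp add: algebra_simps)
    also have "\<dots> < l u y * (l y x * dv E d v)" using adj ell_pos less by simp
    also have "\<dots> \<le> (l u x * dv E d y) * dv E d v"
      using mult_right_mono[OF 1, of "dv E d v"] by (simp add: algebra_simps)
    finally show ?thesis using dy by (simp add: algebra_simps)
  qed
qed

lemma Lve_br: "y \<in> nb v \<Longrightarrow> Lve V E v {v, y} = L \<inter> br v y"
  using edge_in_geod_iff[of v y] nb_edge L_V by (auto simp: Lve_def)

lemma alpha_outside: "v \<in> N \<Longrightarrow> y \<in> nb v \<Longrightarrow> x \<notin> L \<inter> br v y \<Longrightarrow> \<alpha> v {v, y} x = 0"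
  using alpha nb_edge Lve_br unfolding admissible_alpha_def by blast

lemma alpha_sum: "v \<in> N \<Longrightarrow> y \<in> nb v \<Longrightarrow> dv E d v = (\<Sum>x\<in>L \<inter> br v y. \<alpha> v {v, y} x * l v x)"
  using alpha nb_edge Lve_br[of y v] unfolding admissible_alpha_def by auto

lemma alpha_pos_obtain:
  assumes "v \<in> N" "y \<in> nb v"
  obtains x where "x \<in> L \<inter> br v y" "\<alpha> v {v, y} x > 0"
proof -
  have "(\<Sum>x\<in>L \<inter> br v y. \<alpha> v {v, y} x * l v x) \<noteq> 0"
    using alpha_sum[OF assms] dv_pos[OF assms(1)] by simp
  then obtain x where "x \<in> L \<inter> br v y" "\<alpha> v {v, y} x * l v x \<noteq> 0"
    using sum.not_neutral_contains_not_neutral by blast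
  then show thesis using that by auto
qed

end

section \<open>Weights of the equations\<close>

lemma finite_below:
  assumes "finite {x. m x \<noteq> (0::nat)}" shows "finite {a. \<forall>x. a x \<le> m x}"
proof -
  let ?S = "{x. m x \<noteq> 0}"
  have "{a. \<forall>x. a x \<le> m x} \<subseteq> {f. \<forall>x. (x \<in> ?S \<longrightarrow> f x \<in> {..Max (m ` ?S)}) \<and> (x \<notin> ?S \<longrightarrow> f x = 0)}"
  proof
    fix a assume "a \<in> {a. \<forall>x. a x \<le> m x}"
    then have a: "a x \<le> m x" for x by simp
    have "a x = 0" if "m x = 0" for x using a[of x] that by simp
    moreover have "a x \<le> Max (m ` ?S)" if "m x \<noteq> 0" for x
      by (rule order.trans[OF a Max_ge]) (use assms that in auto)
    ultimately show "a \<in> {f. \<forall>x. (x \<in> ?S \<longrightarrow> f x \<in> {..Max (m ` ?S)}) \<and> (x \<notin> ?S \<longrightarrow> f x = 0)}"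
      by simp
  qed
  then show ?thesis by (rule finite_subset) (rule finite_set_of_finite_funs, use assms in auto)
qed

lemma ps_mult_const:
  fixes g :: "'a pseries"
  assumes "finite L" "\<And>m. g m \<noteq> 0 \<Longrightarrow> supp_in L m"
  shows "ps_mult (monomial (\<lambda>_. 0) b) g = (\<lambda>m. b * g m)"
proof
  fix m :: "'a \<Rightarrow> nat"
  let ?S = "{a. \<forall>x. a x \<le> m x}"
  have eq: "ps_mult (monomial (\<lambda>_. 0) b) g m = (\<Sum>a\<in>?S. if a = (\<lambda>_. 0) then b * g m else 0)"
    unfolding ps_mult_def by (rule sum.cong) (auto simp: monomial_def)
  show "ps_mult (monomial (\<lambda>_. 0) b) g m = b * g m"
  proof (cases "g m = 0")
    case True then show ?thesis unfolding eq by (simp add: sum.neutral)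
  next
    case False
    then have "{x. m x \<noteq> 0} \<subseteq> L" using assms(2) by (auto simp: supp_in_def)
    \<comment> \<open>A sum over an infinite index set would be 0, so the coefficient formula of
      \<open>ps_mult\<close> is meaningful only with finitely many lower exponents.\<close>
    then have "finite ?S" using finite_below assms(1) finite_subset by blast
    then show ?thesis unfolding eq by (subst sum.delta) auto
  qed
qed

lemma monomial_const_conv: "monomial (\<lambda>_. 0) b \<in> conv_series L"
proof -
  have "(\<lambda>m. norm (monomial (\<lambda>_. 0) b m) * 1 ^ (\<Sum>x\<in>L. m x)) summable_on (UNIV :: ('a \<Rightarrow> nat) set)"
    by (rule finite_nonzero_values_imp_summable_on)
       (rule finite_subset[of _ "{\<lambda>_. 0}"], auto simp: monomial_def)
  then show ?thesis unfolding conv_series_def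
    by (auto simp: monomial_def supp_in_def intro!: exI[of _ 1])
qed

text \<open>Scalars, as constant series, serve both to combine the equations at a node and to place
  an initial form in the initial ideal.\<close>

lemma ideal_gen_combination:
  assumes "finite L" "\<And>i. i < k \<Longrightarrow> f i \<in> S" "\<And>i m. i < k \<Longrightarrow> f i m \<noteq> 0 \<Longrightarrow> supp_in L m"
  shows "(\<lambda>m. \<Sum>i<(k::nat). b i * f i m) \<in> ideal_gen L S"
proof -
  have "ps_mult (monomial (\<lambda>_. 0) (b i)) (f i) = (\<lambda>m. b i * f i m)" if "i < k" for i
    using ps_mult_const[OF assms(1)] assms(3)[OF that] by blast
  then have "(\<lambda>m. \<Sum>i<k. b i * f i m) = (\<lambda>m. \<Sum>i<k. ps_mult (monomial (\<lambda>_. 0) (b i)) (f i) m)" by auto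
  moreover have "(\<lambda>m. \<Sum>i<k. ps_mult (monomial (\<lambda>_. 0) (b i)) (f i) m) \<in> ideal_gen L S"
    unfolding ideal_gen_def mem_Collect_eq
    by (rule exI[of _ k], rule exI[of _ "\<lambda>i. monomial (\<lambda>_. 0) (b i)"], rule exI[of _ f])
       (simp add: assms(2) monomial_const_conv)
  ultimately show ?thesis by simp
qed

context splice
begin

abbreviation "W \<equiv> wvec V E d"

text \<open>Throughout, \<open>comb s\<close> with \<open>s \<ge> 0\<close> is the weight vector under consideration. Every monomial
  of an equation at \<open>v\<close> has weight at least \<open>base s v\<close>, with strict inequality for the terms of
  higher order; \<open>gap s v y\<close> is the excess for the monomial of the edge towards \<open>y\<close>.\<close>

definition comb :: "('v \<Rightarrow> real) \<Rightarrow> 'v \<Rightarrow> real" where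
  "comb s x = (\<Sum>u\<in>V. s u * W u x)"

definition base :: "('v \<Rightarrow> real) \<Rightarrow> 'v \<Rightarrow> real" where
  "base s v = (\<Sum>u\<in>N. s u * real (l u v))"

definition gap :: "('v \<Rightarrow> real) \<Rightarrow> 'v \<Rightarrow> 'v \<Rightarrow> real" where
  "gap s v y = wt L (comb s) (\<alpha> v {v, y}) - base s v"

lemma W_leaf: "u \<in> L \<Longrightarrow> W u x = (if x = u then 1 else 0)"
  by (simp add: wvec_def)

lemma W_node: "u \<in> N \<Longrightarrow> W u x = (if x \<in> L then real (l u x) else 0)"
  using N_iff N_V by (auto simp: wvec_def)

lemma V_split: "V = N \<union> L" "N \<inter> L = {}"
  by (auto simp: nodes_def leaves_def)

lemma W_nonneg: "u \<in> V \<Longrightarrow> W u x \<ge> 0"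
  using N_iff W_leaf W_node by (cases "u \<in> L") auto

lemma W_off: "u \<in> V \<Longrightarrow> x \<notin> L \<Longrightarrow> W u x = 0"
  using N_iff W_leaf W_node by (cases "u \<in> L") auto

lemma sum_V: "(\<Sum>u\<in>V. f u) = (\<Sum>u\<in>N. f u) + (\<Sum>u\<in>L. (f u :: real))"
  using V_split finite_LN sum.union_disjoint by metis

lemma wt_comb:
  "wt L (comb s) m = (\<Sum>u\<in>N. s u * real (wdot V E d u m)) + (\<Sum>u\<in>L. s u * real (m u))"
proof -
  have "wt L (comb s) m = (\<Sum>x\<in>L. \<Sum>u\<in>V. s u * (W u x * real (m x)))"
    by (simp add: wt_def comb_def sum_distrib_right mult.assoc)
  also have "\<dots> = (\<Sum>u\<in>V. s u * (\<Sum>x\<in>L. W u x * real (m x)))"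
    by (subst sum.swap) (simp add: sum_distrib_left)
  also have "\<dots> = (\<Sum>u\<in>N. s u * (\<Sum>x\<in>L. W u x * real (m x))) + (\<Sum>u\<in>L. s u * (\<Sum>x\<in>L. W u x * real (m x)))"
    by (rule sum_V)
  also have "(\<Sum>u\<in>N. s u * (\<Sum>x\<in>L. W u x * real (m x))) = (\<Sum>u\<in>N. s u * real (wdot V E d u m))"
    by (intro sum.cong refl) (simp add: W_node wdot_def)
  also have "(\<Sum>u\<in>L. s u * (\<Sum>x\<in>L. W u x * real (m x))) = (\<Sum>u\<in>L. s u * real (m u))"
  proof (intro sum.cong refl)
    fix u assume u: "u \<in> L"
    have "(\<Sum>x\<in>L. W u x * real (m x)) = (\<Sum>x\<in>L. if x = u then real (m x) else 0)"
      by (intro sum.cong refl) (simp add: W_leaf u)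
    then show "s u * (\<Sum>x\<in>L. W u x * real (m x)) = s u * real (m u)"
      using u finite_LN by simp
  qed
  finally show ?thesis .
qed

section \<open>Weights of the edge monomials and of the higher terms\<close>

lemma wdot_alpha:
  assumes "v \<in> N" "y \<in> nb v"
  shows "wdot V E d u (\<alpha> v {v, y}) = (\<Sum>x\<in>L \<inter> br v y. \<alpha> v {v, y} x * l u x)"
proof -
  have "(\<Sum>x\<in>L. l u x * \<alpha> v {v, y} x) = (\<Sum>x\<in>L \<inter> br v y. l u x * \<alpha> v {v, y} x)"
    using alpha_outside[OF assms] finite_LN by (intro sum.mono_neutral_right) auto
  then show ?thesis by (simp add: wdot_def mult.commute)
qed

text \<open>On a branch avoiding \<open>u\<close> the ratio of \<open>l u x\<close> to
  \<open>l v x\<close> is constantly \<open>l u v\<close> to \<open>dv E d v\<close>, and the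
  exponents are chosen so that the products \<open>\<alpha> v {v, y} x * l v x\<close> sum to
  \<open>dv E d v\<close>.\<close>

lemma wdot_alpha_outside:
  assumes "u \<in> N" "v \<in> N" "y \<in> nb v" "u \<notin> br v y"
  shows "wdot V E d u (\<alpha> v {v, y}) = l u v"
proof -
  have "l u x * dv E d v = l u v * l v x" if x: "x \<in> L \<inter> br v y" for x
  proof (cases "u = v")
    case False
    then obtain z where z: "u \<in> br v z" using br_obtain[of v u] N_V assms by blast
    then have "x \<notin> br v z" using assms br_disjoint x by blast
    then show ?thesis using ell_outside[OF assms(1,2) z] x L_V by blast
  qed (simp add: ell_self)
  then have "(\<Sum>x\<in>L \<inter> br v y. \<alpha> v {v, y} x * (l u x * dv E d v)) = (\<Sum>x\<in>L \<inter> br v y. \<alpha> v {v, y} x * (l u v * l v x))"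
    by auto
  then have "wdot V E d u (\<alpha> v {v, y}) * dv E d v = l u v * (\<Sum>x\<in>L \<inter> br v y. \<alpha> v {v, y} x * l v x)"
    unfolding wdot_alpha[OF assms(2,3)] by (simp add: sum_distrib_left sum_distrib_right algebra_simps)
  then show ?thesis using alpha_sum[OF assms(2,3)] dv_pos[OF assms(2)] by simp
qed

text \<open>For \<open>u\<close> inside the branch that ratio is strictly larger at each of its
  leaves, and some leaf occurs in the monomial.\<close>

lemma wdot_alpha_inside:
  assumes "u \<in> N" "v \<in> N" "u \<in> br v y"
  shows "wdot V E d u (\<alpha> v {v, y}) > l u v"
proof -
  have y: "y \<in> nb v" using br_nb assms by blast
  obtain x where x: "x \<in> L \<inter> br v y" "\<alpha> v {v, y} x > 0" using alpha_pos_obtain[OF assms(2) y] by blast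
  have "(\<Sum>x\<in>L \<inter> br v y. \<alpha> v {v, y} x * (l u x * dv E d v)) > (\<Sum>x\<in>L \<inter> br v y. \<alpha> v {v, y} x * (l u v * l v x))"
  proof (rule sum_strict_mono_ex1)
    show "\<forall>x\<in>L \<inter> br v y. \<alpha> v {v, y} x * (l u v * l v x) \<le> \<alpha> v {v, y} x * (l u x * dv E d v)"
      using ell_inside[OF assms] by (auto intro!: mult_left_mono less_imp_le)
    show "\<exists>x\<in>L \<inter> br v y. \<alpha> v {v, y} x * (l u v * l v x) < \<alpha> v {v, y} x * (l u x * dv E d v)"
      using ell_inside[OF assms] x by auto
  qed (use finite_LN in auto)
  then have "wdot V E d u (\<alpha> v {v, y}) * dv E d v > l u v * (\<Sum>x\<in>L \<inter> br v y. \<alpha> v {v, y} x * l v x)"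
    unfolding wdot_alpha[OF assms(2) y] by (simp add: sum_distrib_left sum_distrib_right algebra_simps)
  then show ?thesis using alpha_sum[OF assms(2) y] dv_pos[OF assms(2)] by simp
qed

lemma wdot_alpha_ge:
  assumes "u \<in> N" "v \<in> N" "y \<in> nb v"
  shows "wdot V E d u (\<alpha> v {v, y}) \<ge> l u v"
  using wdot_alpha_inside[OF assms(1,2)] wdot_alpha_outside[OF assms] by (cases "u \<in> br v y") force+

lemma gap_eq:
  "gap s v y = (\<Sum>u\<in>N. s u * (real (wdot V E d u (\<alpha> v {v, y})) - real (l u v)))
     + (\<Sum>u\<in>L. s u * real (\<alpha> v {v, y} u))"
  by (simp add: gap_def wt_comb base_def sum_subtractf algebra_simps)

lemma gap_terms:
  assumes "\<forall>u. s u \<ge> 0" "v \<in> N" "y \<in> nb v"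
  shows "(\<Sum>u\<in>N. s u * (real (wdot V E d u (\<alpha> v {v, y})) - real (l u v))) \<ge> 0"
    "(\<Sum>u\<in>L. s u * real (\<alpha> v {v, y} u)) \<ge> 0"
    "gap s v y \<ge> 0"
  using wdot_alpha_ge[OF _ assms(2,3)] assms(1) unfolding gap_eq
  by (auto intro!: sum_nonneg add_nonneg_nonneg)

lemma gap_pos_node:
  assumes "\<forall>u. s u \<ge> 0" "v \<in> N" "u \<in> N" "u \<in> br v y" "s u > 0"
  shows "gap s v y > 0"
proof -
  have y: "y \<in> nb v" using br_nb assms by blast
  have "(\<Sum>u\<in>N. s u * (real (wdot V E d u (\<alpha> v {v, y})) - real (l u v))) > 0"
    using wdot_alpha_ge[OF _ assms(2) y] wdot_alpha_inside[OF assms(3,2,4)] assms finite_LN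
    by (intro sum_pos2[of _ u]) auto
  then show ?thesis using gap_terms(2)[OF assms(1,2) y] unfolding gap_eq by linarith
qed

lemma gap_pos_leaf:
  assumes "\<forall>u. s u \<ge> 0" "v \<in> N" "y \<in> nb v" "u \<in> L" "s u > 0" "\<alpha> v {v, y} u > 0"
  shows "gap s v y > 0"
proof -
  have "(\<Sum>u\<in>L. s u * real (\<alpha> v {v, y} u)) > 0"
    using assms finite_LN by (intro sum_pos2[of _ u]) auto
  then show ?thesis using gap_terms(1)[OF assms(1-3)] unfolding gap_eq by linarith
qed

lemma gap_pos_all_leaves:
  assumes "\<forall>u. s u \<ge> 0" "v \<in> N" "y \<in> nb v" "\<And>u. u \<in> L \<inter> br v y \<Longrightarrow> s u > 0"
  shows "gap s v y > 0"
  using alpha_pos_obtain[OF assms(2,3)] gap_pos_leaf[OF assms(1-3)] assms(4) by blast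

lemma gap_zero:
  assumes "v \<in> N" "y \<in> nb v" "\<And>u. u \<in> br v y \<Longrightarrow> s u = 0"
  shows "gap s v y = 0"
proof -
  have "s u * (real (wdot V E d u (\<alpha> v {v, y})) - real (l u v)) = 0" if "u \<in> N" for u
    using wdot_alpha_outside[OF that assms(1,2)] assms(3) by (cases "u \<in> br v y") auto
  moreover have "s u * real (\<alpha> v {v, y} u) = 0" if "u \<in> L" for u
    using alpha_outside[OF assms(1,2), of u] assms(3) by (cases "u \<in> br v y") auto
  ultimately have "(\<Sum>u\<in>N. s u * (real (wdot V E d u (\<alpha> v {v, y})) - real (l u v))) = 0"
    "(\<Sum>u\<in>L. s u * real (\<alpha> v {v, y} u)) = 0" by (intro sum.neutral ballI; blast)+
  then show ?thesis unfolding gap_eq by linarith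
qed

text \<open>A supported node brings its own strict inequality. Without one,
  \<open>base s v = 0\<close>, and strictness comes from the positive coordinates, since
  \<open>m\<close> is not the zero exponent.\<close>

lemma higher_weight:
  assumes s: "\<forall>u. s u \<ge> 0" and w: "\<And>x. x \<in> L \<Longrightarrow> comb s x > 0" and v: "v \<in> N"
    and m: "wdot V E d v m > dv E d v" "\<And>u. u \<in> N \<Longrightarrow> u \<noteq> v \<Longrightarrow> wdot V E d u m > l u v"
  shows "wt L (comb s) m > base s v"
proof -
  have gt: "wdot V E d u m > l u v" if "u \<in> N" for u
    using m that by (cases "u = v") (auto simp: ell_self)
  have le: "(\<Sum>u\<in>L. s u * real (m u)) \<ge> 0" using s by (auto intro!: sum_nonneg)
  show ?thesis
  proof (cases "\<exists>u\<in>N. s u > 0")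
    case True
    then obtain u where u: "u \<in> N" "s u > 0" by blast
    have "base s v < (\<Sum>u\<in>N. s u * real (wdot V E d u m))" unfolding base_def
    proof (rule sum_strict_mono_ex1)
      show "\<forall>u\<in>N. s u * real (l u v) \<le> s u * real (wdot V E d u m)"
        using gt s by (simp add: mult_left_mono less_imp_le)
      show "\<exists>u\<in>N. s u * real (l u v) < s u * real (wdot V E d u m)"
        using gt u by (intro bexI[of _ u]) auto
    qed (use finite_LN in auto)
    then show ?thesis using le by (simp add: wt_comb)
  next
    case False
    then have "s u = 0" if "u \<in> N" for u using s that by (metis less_eq_real_def)
    then have 0: "base s v = 0" by (simp add: base_def)
    have "wdot V E d v m \<noteq> 0" using m(1) by simp
    then obtain x where "x \<in> L" "l v x * m x \<noteq> 0"
      unfolding wdot_def by (rule sum.not_neutral_contains_not_neutral)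
    then have x: "x \<in> L" "m x \<noteq> 0" by auto
    have "wt L (comb s) m > 0" unfolding wt_def
      using x w finite_LN by (intro sum_pos2[of _ x]) (simp_all add: less_imp_le)
    then show ?thesis using 0 by simp
  qed
qed

text \<open>A leaf occurring in the monomial of an edge lies in the branch of that edge, and
  branches are disjoint. So the edge monomials at \<open>v\<close> cannot merge or cancel.\<close>

lemma alpha_inj:
  assumes "v \<in> N" "y \<in> nb v" "z \<in> nb v" "\<alpha> v {v, y} = \<alpha> v {v, z}" shows "y = z"
proof -
  obtain x where x: "x \<in> L \<inter> br v y" "\<alpha> v {v, y} x > 0" using alpha_pos_obtain assms by blast
  then have "x \<in> br v z" using alpha_outside[OF assms(1,3), of x] assms(4) by auto
  then show ?thesis using br_disjoint x by blast
qed

lemma edges_at_nb: "edges_at E v = (\<lambda>y. {v, y}) ` nb v"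
  using edges_nb by (simp add: edges_at_def)

text \<open>If some, but at most \<^term>\<open>valency E v - 2\<close>, of the monomials at \<^term>\<open>v\<close> had minimal
  weight, the minor condition would isolate one of them by a linear combination of the
  equations at \<^term>\<open>v\<close>.\<close>

lemma few_gaps:
  assumes s: "\<forall>u. s u \<ge> 0" and trop: "comb s \<in> trop_pos V E F" and v: "v \<in> N"
    and y0: "y0 \<in> nb v" "gap s v y0 = 0"
  shows "card {y \<in> nb v. gap s v y > 0} \<le> 1"
proof (rule ccontr)
  let ?P = "{y \<in> nb v. gap s v y > 0}" and ?n = "valency E v - 2" and ?w = "comb s"
  assume "\<not> card ?P \<le> 1"
  \<comment> \<open>Dropping two edges of positive gap leaves a square block of rows; every edge of
    minimal weight stays in \<open>S\<close>.\<close>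
  then obtain P where P: "P \<subseteq> ?P" "card P = 2" "finite P"
    using obtain_subset_with_card_n[of 2 ?P] by auto
  define S where "S = nb v - P"
  have cS: "card S = ?n" using P finite_nb by (simp add: S_def card_Diff_subset valency_nb subset_iff)
  have y0S: "y0 \<in> S" using y0 P by (auto simp: S_def)
  have fS: "finite S" using finite_nb by (simp add: S_def)
  obtain en where en: "bij_betw en {..<?n} S"
    using ex_bij_betw_nat_finite[OF fS] cS by (auto simp: atLeast0LessThan)
  obtain j0 where j0: "j0 < ?n" "en j0 = y0" using en y0S by (auto simp: bij_betw_def)
  let ?g = "\<lambda>c i g. g \<in> conv_series L \<and>
         (\<forall>m. g m \<noteq> 0 \<longrightarrow> wdot V E d v m > dv E d v \<and>
                (\<forall>u\<in>N. u \<noteq> v \<longrightarrow> wdot V E d u m > l u v)) \<and>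
         F v i = (\<lambda>m. (\<Sum>e\<in>edges_at E v. c e i * monomial (\<alpha> v e) 1 m) + g m)"
  from system v have "\<exists>c. maximal_minors_nonzero E v c \<and> (\<forall>i\<in>{1..?n}. \<exists>g. ?g c i g)"
    unfolding splice_type_system_def by (rule bspec)
  then obtain c where c: "maximal_minors_nonzero E v c" and "\<forall>i\<in>{1..?n}. \<exists>g. ?g c i g"
    by (elim exE conjE)
  from bchoice[OF this(2)] obtain g where "\<forall>i\<in>{1..?n}. ?g c i (g i)" by (elim exE)
  from bspec[OF this] have g: "?g c i (g i)" if "i \<in> {1..?n}" for i using that .
  have gF: "F v (Suc i) m = (\<Sum>e\<in>edges_at E v. c e (Suc i) * monomial (\<alpha> v e) 1 m) + g (Suc i) m"
    and gS: "g (Suc i) m \<noteq> 0 \<Longrightarrow> supp_in L m"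
    and gW: "g (Suc i) m \<noteq> 0 \<Longrightarrow> wdot V E d v m > dv E d v"
      "\<And>u. g (Suc i) m \<noteq> 0 \<Longrightarrow> u \<in> N \<Longrightarrow> u \<noteq> v \<Longrightarrow> wdot V E d u m > l u v" if "i < ?n" for i m
  proof -
    have i: "Suc i \<in> {1..?n}" using that by simp
    show "F v (Suc i) m = (\<Sum>e\<in>edges_at E v. c e (Suc i) * monomial (\<alpha> v e) 1 m) + g (Suc i) m"
      using g[OF i] by metis
    show "g (Suc i) m \<noteq> 0 \<Longrightarrow> supp_in L m" using g[OF i] unfolding conv_series_def by blast
    show "g (Suc i) m \<noteq> 0 \<Longrightarrow> wdot V E d v m > dv E d v"
      "\<And>u. g (Suc i) m \<noteq> 0 \<Longrightarrow> u \<in> N \<Longrightarrow> u \<noteq> v \<Longrightarrow> wdot V E d u m > l u v"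
      using g[OF i] by blast+
  qed
  define A where "A = mat ?n ?n (\<lambda>(j, i). c {v, en j} (Suc i))"
  have A: "A \<in> carrier_mat ?n ?n" by (simp add: A_def)
  have "bij_betw (\<lambda>y. {v, y}) S ((\<lambda>y. {v, y}) ` S)"
    using inj_nb by (auto simp: bij_betw_def S_def intro: inj_on_subset)
  from bij_betw_trans[OF en this]
  have "bij_betw (\<lambda>j. {v, en j}) {..<?n} ((\<lambda>y. {v, y}) ` S)" by (simp add: comp_def)
  moreover have "(\<lambda>y. {v, y}) ` S \<subseteq> edges_at E v" by (auto simp: edges_at_nb S_def)
  moreover from calculation(1) have "card ((\<lambda>y. {v, y}) ` S) = ?n" using bij_betw_same_card by fastforce
  ultimately have det: "det A \<noteq> 0"
    using c unfolding maximal_minors_nonzero_def A_def by blast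
  \<comment> \<open>A column of the adjugate: \<open>A\<close> times it is \<open>det A\<close>
    times the unit vector of \<open>j0\<close>, so among the edges in \<open>S\<close> only the
    monomial of \<open>y0\<close> survives.\<close>
  define b where "b i = adj_mat A $$ (i, j0)" for i
  define q where "q e = (\<Sum>i<?n. b i * c e (Suc i))" for e
  have q: "q {v, en j} = (if j = j0 then det A else 0)" if j: "j < ?n" for j
  proof -
    have "(A * adj_mat A) $$ (j, j0) = (\<Sum>i<?n. A $$ (j, i) * adj_mat A $$ (i, j0))"
      using A adj_mat(1)[OF A] j j0 by (simp add: scalar_prod_def atLeast0LessThan)
    moreover have "(A * adj_mat A) $$ (j, j0) = (if j = j0 then det A else 0)"
      unfolding adj_mat(2)[OF A] using j j0 by simp
    ultimately show ?thesis using j by (simp add: q_def b_def A_def mult.commute)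
  qed
  have qS: "q {v, y} = (if y = y0 then det A else 0)" if yS: "y \<in> S" for y
  proof -
    obtain j where "j < ?n" "en j = y" using en yS by (auto simp: bij_betw_def)
    then show ?thesis using q[of j] j0 en by (auto simp: bij_betw_def inj_on_def)
  qed
  define h where "h m = (\<Sum>i<?n. b i * g (Suc i) m)" for m
  define f where "f m = (\<Sum>i<?n. b i * F v (Suc i) m)" for m
  have f: "f m = (\<Sum>y\<in>nb v. q {v, y} * monomial (\<alpha> v {v, y}) 1 m) + h m" for m
  proof -
    have "f m = (\<Sum>i<?n. b i * (\<Sum>e\<in>edges_at E v. c e (Suc i) * monomial (\<alpha> v e) 1 m) + b i * g (Suc i) m)"
      unfolding f_def by (intro sum.cong refl) (simp add: gF distrib_left)
    also have "\<dots> = (\<Sum>i<?n. \<Sum>e\<in>edges_at E v. b i * c e (Suc i) * monomial (\<alpha> v e) 1 m) + h m"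
      by (simp add: sum.distrib h_def sum_distrib_left mult.assoc)
    also have "\<dots> = (\<Sum>e\<in>edges_at E v. q e * monomial (\<alpha> v e) 1 m) + h m"
      by (subst sum.swap) (simp add: q_def sum_distrib_right)
    also have "(\<Sum>e\<in>edges_at E v. q e * monomial (\<alpha> v e) 1 m) = (\<Sum>y\<in>nb v. q {v, y} * monomial (\<alpha> v {v, y}) 1 m)"
      unfolding edges_at_nb using inj_nb by (simp add: sum.reindex)
    finally show ?thesis .
  qed
  have wpos: "?w x > 0" if "x \<in> L" for x using trop that by (simp add: trop_pos_def)
  have h0: "h m = 0" if "wt L ?w m \<le> base s v" for m
  proof -
    have "g (Suc i) m = 0" if i: "i < ?n" for i
    proof (rule ccontr)
      assume "g (Suc i) m \<noteq> 0"
      from higher_weight[OF s wpos v gW(1)[OF i this] gW(2)[OF i this]] show False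
        using \<open>wt L ?w m \<le> base s v\<close> by simp
    qed
    then show ?thesis by (simp add: h_def)
  qed
  let ?m0 = "\<alpha> v {v, y0}"
  have wm0: "wt L ?w ?m0 = base s v" using y0 by (simp add: gap_def)
  have "(\<Sum>y\<in>nb v. q {v, y} * monomial (\<alpha> v {v, y}) 1 ?m0) = (\<Sum>y\<in>nb v. if y = y0 then q {v, y} else 0)"
    using alpha_inj[OF v] y0 by (intro sum.cong) (auto simp: monomial_def)
  also have "\<dots> = det A" using qS[OF y0S] y0 finite_nb by simp
  finally have f0: "f ?m0 = det A" using h0[of ?m0] wm0 by (simp add: f)
  \<comment> \<open>Edges outside \<open>S\<close> have positive gap, those in \<open>S\<close> have
    coefficient 0 except \<open>y0\<close>, and the higher terms are too heavy.\<close>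
  have f1: "m = ?m0" if m: "f m \<noteq> 0" "wt L ?w m \<le> base s v" for m
  proof -
    have "(\<Sum>y\<in>nb v. q {v, y} * monomial (\<alpha> v {v, y}) 1 m) \<noteq> 0" using m h0[OF m(2)] f by simp
    then obtain y where y: "y \<in> nb v" "q {v, y} * monomial (\<alpha> v {v, y}) 1 m \<noteq> 0"
      by (rule sum.not_neutral_contains_not_neutral)
    then have y: "y \<in> nb v" "q {v, y} \<noteq> 0" "m = \<alpha> v {v, y}"
      by (auto simp: monomial_def split: if_splits)
    then have "gap s v y \<le> 0" using m by (simp add: gap_def)
    then have "y \<in> S" using P y by (auto simp: S_def)
    then have "y = y0" using qS[of y] y(2) by (auto split: if_splits)
    then show ?thesis using y(3) by simp
  qed
  have init: "init_form L ?w f = monomial ?m0 (det A)"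
  proof
    fix m
    have "f m \<noteq> 0 \<and> (\<forall>m'. f m' \<noteq> 0 \<longrightarrow> wt L ?w m \<le> wt L ?w m') \<longleftrightarrow> m = ?m0"
    proof
      assume "f m \<noteq> 0 \<and> (\<forall>m'. f m' \<noteq> 0 \<longrightarrow> wt L ?w m \<le> wt L ?w m')"
      then have "f m \<noteq> 0" "f ?m0 \<noteq> 0 \<longrightarrow> wt L ?w m \<le> wt L ?w ?m0" by blast+
      then show "m = ?m0" using f1[of m] f0 det wm0 by simp
    next
      assume m: "m = ?m0"
      have "wt L ?w ?m0 \<le> wt L ?w m'" if "f m' \<noteq> 0" for m'
        using f1[OF that] wm0 by (cases "wt L ?w m' \<le> base s v") auto
      then show "f m \<noteq> 0 \<and> (\<forall>m'. f m' \<noteq> 0 \<longrightarrow> wt L ?w m \<le> wt L ?w m')" using m f0 det by simp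
    qed
    then show "init_form L ?w f m = monomial ?m0 (det A) m"
      using f0 by (simp add: init_form_def monomial_def)
  qed
  have supp_alpha: "supp_in L (\<alpha> v {v, y})" if "y \<in> nb v" for y
    unfolding supp_in_def
  proof (intro allI impI)
    fix x assume "\<alpha> v {v, y} x \<noteq> 0"
    then show "x \<in> L" using alpha_outside[OF v that, of x] by (cases "x \<in> L") auto
  qed
  have supp_F: "supp_in L m" if "i < ?n" "F v (Suc i) m \<noteq> 0" for i m
  proof (cases "g (Suc i) m = 0")
    case True
    then have "(\<Sum>e\<in>edges_at E v. c e (Suc i) * monomial (\<alpha> v e) 1 m) \<noteq> 0"
      using gF[of i m] that by simp
    then obtain e where e: "e \<in> edges_at E v" "c e (Suc i) * monomial (\<alpha> v e) 1 m \<noteq> 0"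
      by (rule sum.not_neutral_contains_not_neutral)
    then have "e \<in> edges_at E v" "m = \<alpha> v e" by (auto simp: monomial_def split: if_splits)
    then show ?thesis using supp_alpha by (auto simp: edges_at_nb)
  next
    case False
    then show ?thesis using gS that by blast
  qed
  have "f \<in> splice_ideal V E F" unfolding splice_ideal_def f_def[abs_def]
  proof (rule ideal_gen_combination[OF finite_LN(1)])
    fix i assume i: "i < ?n"
    then show "F v (Suc i) \<in> {F v i |v i. v \<in> N \<and> i \<in> {1..valency E v - 2}}"
      using v by (intro CollectI exI[of _ v] exI[of _ "Suc i"]) simp
    show "F v (Suc i) m \<noteq> 0 \<Longrightarrow> supp_in L m" for m using supp_F i by blast
  qed
  then have "init_form L ?w f \<in> init_form L ?w ` splice_ideal V E F" by (rule imageI)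
  then have im: "monomial ?m0 (det A) \<in> init_form L ?w ` splice_ideal V E F" unfolding init .
  have "(\<lambda>m. \<Sum>i<(1::nat). 1 * monomial ?m0 (det A) m) \<in> init_ideal L ?w (splice_ideal V E F)"
    unfolding init_ideal_def
  proof (rule ideal_gen_combination[OF finite_LN(1) im])
    show "monomial ?m0 (det A) m \<noteq> 0 \<Longrightarrow> supp_in L m" for m
      using supp_alpha[OF y0(1)] by (auto simp: monomial_def split: if_splits)
  qed
  then have "monomial ?m0 (det A) \<in> init_ideal L ?w (splice_ideal V E F)" by simp
  moreover have "\<not> (\<exists>m c. c \<noteq> 0 \<and> supp_in L m \<and> monomial m c \<in> init_ideal L ?w (splice_ideal V E F))"
    using trop unfolding trop_pos_def by (elim CollectE conjE)
  ultimately show False using det supp_alpha[OF y0(1)] by blast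
qed

lemma all_gaps:
  assumes "\<forall>u. s u \<ge> 0" "comb s \<in> trop_pos V E F" "v \<in> N"
    "y \<in> nb v" "gap s v y > 0" "z \<in> nb v" "gap s v z > 0" "y \<noteq> z" "x \<in> nb v"
  shows "gap s v x > 0"
proof (rule ccontr)
  assume "\<not> ?thesis"
  then have "gap s v x = 0" using gap_terms(3)[OF assms(1,3,9)] by simp
  from few_gaps[OF assms(1-3,9) this] have "card {y \<in> nb v. gap s v y > 0} \<le> 1" .
  then show False using assms(4-8) finite_nb by (auto simp: card_le_Suc0_iff_eq)
qed

section \<open>Star-full subtrees\<close>

text \<open>Star-full subtrees are encoded by their vertex sets alone, since a connected subgraph of a tree
  is induced; the second conjunct is connectedness.\<close>

definition star_sub :: "'v set \<Rightarrow> bool" where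
  "star_sub X \<longleftrightarrow> X \<subseteq> V \<and> (\<forall>y\<in>X. \<forall>z. X \<inter> br y z \<noteq> {} \<longrightarrow> z \<in> X) \<and>
     (\<forall>x\<in>X. nb x \<subseteq> X \<or> card (nb x \<inter> X) \<le> 1)"

text \<open>At most 1, so that the vertex of a one-point subtree counts as boundary, just as it
  belongs to \<open>subtree_leaves\<close>.\<close>

definition bd :: "'v set \<Rightarrow> 'v set" where
  "bd X = {x \<in> X. card (nb x \<inter> X) \<le> 1}"

lemma star_sub_V: "star_sub X \<Longrightarrow> x \<in> X \<Longrightarrow> x \<in> V"
  by (auto simp: star_sub_def)

lemma star_sub_step: "star_sub X \<Longrightarrow> y \<in> X \<Longrightarrow> x \<in> X \<Longrightarrow> x \<in> br y z \<Longrightarrow> z \<in> X"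
  unfolding star_sub_def by blast

lemma finite_star_sub: "star_sub X \<Longrightarrow> finite X"
  using finite_V finite_subset by (auto simp: star_sub_def)

lemma bd_subset: "x \<in> bd X \<Longrightarrow> x \<in> X"
  by (simp add: bd_def)

lemma bd_unique:
  assumes "x \<in> bd X" "y \<in> nb x \<inter> X" "z \<in> nb x \<inter> X" shows "y = z"
proof -
  have "card (nb x \<inter> X) \<le> Suc 0" using assms(1) by (simp add: bd_def)
  then show ?thesis using assms(2,3) finite_nb by (auto simp: card_le_Suc0_iff_eq)
qed

lemma inner:
  assumes "star_sub X" "x \<in> X" "x \<notin> bd X" shows "nb x \<subseteq> X" "x \<in> N"
proof -
  show "nb x \<subseteq> X" using assms unfolding star_sub_def bd_def by blast
  then have "nb x \<inter> X = nb x" by blast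
  then have "card (nb x) > 1" using assms by (auto simp: bd_def)
  then show "x \<in> N" using assms star_sub_V valency_nb by (auto simp: nodes_def)
qed

lemma br_bd:
  assumes X: "star_sub X" and x: "x \<in> bd X" and y: "y \<in> X" "x \<in> nb y"
  shows "br y x \<inter> X = {x}"
proof -
  have yx: "{y, x} \<in> E" using y by auto
  have "x' = x" if x': "x' \<in> br y x" "x' \<in> X" for x'
  proof (rule ccontr)
    assume "x' \<noteq> x"
    then obtain z where z: "z \<noteq> y" "x' \<in> br x z" using x' br_unfold[OF yx] by blast
    have "z \<in> X" using star_sub_step[OF X bd_subset[OF x] x'(2) z(2)] .
    moreover have "z \<in> nb x" "y \<in> nb x" using br_nb[OF z(2)] y(2) nb_sym by auto
    ultimately show False using bd_unique[OF x] y(1) z(1) by blast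
  qed
  then show ?thesis using br_separates(2)[OF yx] bd_subset[OF x] by blast
qed

text \<open>Nothing of \<open>X\<close> lies beyond a boundary vertex, and the two opposite branches
  of an edge cover the tree. This makes the base case of the final induction an edge.\<close>

lemma bd_pair:
  assumes X: "star_sub X" and x: "x \<in> bd X" and y: "y \<in> bd X" "x \<in> nb y"
  shows "X \<subseteq> {x, y}"
proof
  fix u assume u: "u \<in> X"
  have "y \<in> nb x" using y nb_sym by blast
  then have "br y x \<inter> X = {x}" "br x y \<inter> X = {y}"
    using br_bd[OF X x bd_subset[OF y(1)] y(2)] br_bd[OF X y(1) bd_subset[OF x]] by auto
  moreover have "u \<in> br y x \<or> u \<in> br x y"
    using br_opposite[of x y] \<open>y \<in> nb x\<close> star_sub_V[OF X u] by auto
  ultimately show "u \<in> {x, y}" using u by blast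
qed

lemma comb_leaf:
  assumes "\<And>u. u \<in> N \<Longrightarrow> s u = 0" "x \<in> L" shows "comb s x = s x"
proof -
  have "comb s x = (\<Sum>u\<in>L. s u * W u x)" using assms(1) by (simp add: comb_def sum_V)
  also have "\<dots> = (\<Sum>u\<in>L. if u = x then s u else 0)"
    by (intro sum.cong refl) (simp add: W_leaf)
  finally show ?thesis using assms(2) finite_LN by simp
qed

text \<open>A supported leaf need not occur in the monomial \<open>\<alpha> v {v, y}\<close> of its branch, so it does not by
  itself make the gap positive. If a supported node lies outside the branch, the equations inside
  the branch force all its leaves to be supported, and some leaf does occur in the monomial.\<close>

lemma supported_leaves:
  assumes X: "star_sub X" and s: "\<forall>u. s u \<ge> 0" "\<And>u. u \<notin> X \<Longrightarrow> s u = 0"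
    and trop: "comb s \<in> trop_pos V E F"
    and "y \<in> X" "x \<in> X" "x \<in> nb y"
    and u0: "u0 \<in> N" "u0 \<notin> br y x" "s u0 > 0"
    and "\<And>u. u \<in> N \<Longrightarrow> u \<in> br y x \<Longrightarrow> s u = 0"
    and "u1 \<in> br y x" "s u1 > 0"
    and "k \<in> L" "k \<in> br y x"
  shows "s k > 0"
  using assms(5-)
proof (induction "card (br y x)" arbitrary: y x u1 k rule: less_induct)
  case less
  have yx: "{y, x} \<in> E" "y \<in> nb x" using less.prems(3) nb_sym by auto
  have u1X: "u1 \<in> X" using less.prems(9) s(2)[of u1] by force
  show ?case
  proof (cases "x \<in> bd X")
    case True
    have "br y x \<inter> X = {x}" using br_bd[OF X True] less.prems by blast
    then have "u1 = x" using u1X less.prems by blast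
    then have "x \<notin> N" using less.prems(7)[of x] less.prems(8,9) by auto
    then have "x \<in> L" using N_iff nb_V(2)[OF less.prems(3)] by blast
    then have "k = x" using br_leaf less.prems(3,11) by blast
    then show ?thesis using \<open>u1 = x\<close> less.prems by simp
  next
    case False
    note inn = inner[OF X less.prems(2) False]
    have sub: "u \<in> br y x" if "z \<noteq> y" "u \<in> br x z" for u z
      using br_unfold[OF yx(1)] that br_edge[OF that(2)] by blast
    have IH: "s k > 0" if h: "z \<noteq> y" "v \<in> br x z" "s v > 0" "k \<in> L" "k \<in> br x z" for z v k
    proof -
      have z: "z \<in> nb x" using br_nb h by blast
      have "card (br x z) < card (br y x)" using card_br_less[OF yx(1) br_edge[OF h(2)] h(1)] .
      moreover have "u0 \<notin> br x z" using less.prems(5) sub h(1) by blast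
      moreover have "s u = 0" if "u \<in> N" "u \<in> br x z" for u
        using less.prems(7)[OF that(1) sub[OF h(1) that(2)]] .
      ultimately show ?thesis using less.hyps[of x z v k] less.prems(2,4,6) inn z h by blast
    qed
    have "s x = 0" using less.prems(7)[OF inn(2)] br_separates(2)[OF yx(1)] by blast
    then have "u1 \<noteq> x" using less.prems by auto
    then obtain z where z: "z \<noteq> y" "u1 \<in> br x z" using br_unfold[OF yx(1)] less.prems(8) by blast
    have zn: "z \<in> nb x" using br_nb z by blast
    have g1: "gap s x z > 0"
      using gap_pos_all_leaves[OF s(1) inn(2) zn] IH[OF z less.prems(9)] by blast
    have "u0 \<in> br x y" using br_opposite[OF yx(1)] less.prems(4,5) N_V by blast
    then have g2: "gap s x y > 0" using gap_pos_node[OF s(1) inn(2)] less.prems by blast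
    have "k \<noteq> x" using less.prems(10) inn N_iff N_V by blast
    then obtain z' where z': "z' \<noteq> y" "k \<in> br x z'" using br_unfold[OF yx(1)] less.prems(11) by blast
    have zn': "z' \<in> nb x" using br_nb z' by blast
    \<comment> \<open>The branch of \<open>u1\<close> and the direction back to \<open>u0\<close>
      both have positive gap, hence so does the branch of \<open>k\<close>. It therefore contains a
      supported vertex, as the induction hypothesis requires.\<close>
    have "gap s x z' > 0" using all_gaps[OF s(1) trop inn(2) zn g1 yx(2) g2 z(1) zn'] .
    then have "\<not> (\<forall>u. u \<in> br x z' \<longrightarrow> s u = 0)" using gap_zero[OF inn(2) zn', of s] by auto
    then obtain v where "v \<in> br x z'" "s v > 0" using s(1) by (metis less_eq_real_def)
    then show ?thesis using IH[OF z'(1) _ _ less.prems(10) z'(2)] by blast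
  qed
qed

text \<open>A converse of \<open>gap_zero\<close> under tropicality. If the branch has no supported
  node, all its leaves are supported: by \<open>supported_leaves\<close> if a node elsewhere is
  supported, and otherwise because \<open>comb s\<close> is positive and equals \<open>s\<close> on
  the leaves.\<close>

lemma gap_pos:
  assumes X: "star_sub X" and s: "\<forall>u. s u \<ge> 0" "\<And>u. u \<notin> X \<Longrightarrow> s u = 0"
    and trop: "comb s \<in> trop_pos V E F"
    and y: "y \<in> X" "y \<notin> bd X" and u: "u \<in> br y z" "s u > 0"
  shows "gap s y z > 0"
proof -
  note inn = inner[OF X y]
  have z: "z \<in> nb y" using br_nb u by blast
  show ?thesis
  proof (cases "\<exists>u\<in>N. u \<in> br y z \<and> s u > 0")
    case True then show ?thesis using gap_pos_node[OF s(1) inn(2)] by blast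
  next
    case False
    then have no: "s u = 0" if "u \<in> N" "u \<in> br y z" for u using s(1) that by (metis less_eq_real_def)
    have "s k > 0" if k: "k \<in> L \<inter> br y z" for k
    proof (cases "\<exists>u\<in>N. s u > 0")
      case True
      then obtain u0 where "u0 \<in> N" "s u0 > 0" "u0 \<notin> br y z" using no by force
      then show ?thesis using supported_leaves[OF X s trop y(1) _ z _ _ _ no u] inn z k by blast
    next
      case False
      then have "s u = 0" if "u \<in> N" for u using s(1) that by (metis less_eq_real_def)
      then have "comb s k = s k" using comb_leaf k by blast
      then show ?thesis using trop k by (auto simp: trop_pos_def)
    qed
    then show ?thesis using gap_pos_all_leaves[OF s(1) inn(2) z] by blast
  qed
qed

text \<open>The empty branch \<open>z0\<close> has gap zero, which allows at most one positive gap,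
  and every supported branch has one. Only branches are restricted; \<open>y\<close> itself may be
  supported.\<close>

lemma one_supported_branch:
  assumes X: "star_sub X" and s: "\<forall>u. s u \<ge> 0" "\<And>u. u \<notin> X \<Longrightarrow> s u = 0"
    and trop: "comb s \<in> trop_pos V E F"
    and y: "y \<in> X" "y \<notin> bd X" and z0: "z0 \<in> nb y" "\<And>u. u \<in> br y z0 \<Longrightarrow> s u = 0"
  obtains z where "z \<in> nb y" "z \<noteq> z0" "\<And>u z'. u \<in> br y z' \<Longrightarrow> z' \<noteq> z \<Longrightarrow> s u = 0"
proof -
  note inn = inner[OF X y]
  have g0: "gap s y z0 = 0" using gap_zero[OF inn(2) z0] .
  show thesis
  proof (cases "\<exists>z u. u \<in> br y z \<and> s u > 0")
    case True
    then obtain z u where z: "u \<in> br y z" "s u > 0" by blast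
    have zn: "z \<in> nb y" using br_nb z by blast
    have "z \<noteq> z0" using z z0 by force
    moreover have "s u' = 0" if z': "u' \<in> br y z'" "z' \<noteq> z" for u' z'
    proof (rule ccontr)
      assume "s u' \<noteq> 0"
      then have "s u' > 0" using s(1) by (metis less_eq_real_def)
      then have "gap s y z' > 0" "gap s y z > 0" using gap_pos[OF X s trop y] z z' by blast+
      then have "gap s y z0 > 0"
        using all_gaps[OF s(1) trop inn(2) br_nb[OF z'(1)] _ zn _ z'(2) z0(1)] by blast
      then show False using g0 by simp
    qed
    ultimately show thesis using that zn by blast
  next
    case False
    then have 0: "s u = 0" if "u \<in> br y z" for u z using s(1) that by (metis less_eq_real_def)
    \<comment> \<open>With no supported branch, any neighbour other than \<open>z0\<close> is a
      valid answer.\<close>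
    have "\<not> nb y \<subseteq> {z0}" using N_card[OF inn(2)] card_mono[of "{z0}" "nb y"] by auto
    then show thesis using that 0 by blast
  qed
qed

section \<open>Inner vertices in the cone spanned by the boundary\<close>

definition in_cone :: "'v set \<Rightarrow> ('v \<Rightarrow> real) \<Rightarrow> bool" where
  "in_cone X f \<longleftrightarrow> (\<exists>c. (\<forall>u. c u \<ge> 0) \<and> (\<forall>u. u \<notin> bd X \<longrightarrow> c u = 0) \<and> f = comb c)"

lemma comb_add: "comb (\<lambda>u. s u + t u) x = comb s x + comb t x"
  by (simp add: comb_def distrib_right sum.distrib)

lemma comb_scale: "comb (\<lambda>u. a * s u) x = a * comb s x"
  by (simp add: comb_def sum_distrib_left mult.assoc)

lemma comb_single: "v \<in> V \<Longrightarrow> comb (\<lambda>u. if u = v then a else 0) x = a * W v x"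
proof -
  assume v: "v \<in> V"
  have "comb (\<lambda>u. if u = v then a else 0) x = (\<Sum>u\<in>V. if u = v then a * W u x else 0)"
    unfolding comb_def by (intro sum.cong) auto
  then show ?thesis using v finite_V by simp
qed

lemma in_cone_add: assumes "in_cone X f" "in_cone X g" shows "in_cone X (\<lambda>x. f x + g x)"
proof -
  obtain c e where "\<forall>u. c u \<ge> 0" "\<forall>u. u \<notin> bd X \<longrightarrow> c u = 0" "f = comb c"
    "\<forall>u. e u \<ge> 0" "\<forall>u. u \<notin> bd X \<longrightarrow> e u = 0" "g = comb e" using assms unfolding in_cone_def by blast
  then show ?thesis unfolding in_cone_def
    by (intro exI[of _ "\<lambda>u. c u + e u"]) (auto simp: comb_add)
qed

lemma in_cone_scale: assumes "in_cone X f" "a \<ge> 0" shows "in_cone X (\<lambda>x. a * f x)"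
proof -
  obtain c where "\<forall>u. c u \<ge> 0" "\<forall>u. u \<notin> bd X \<longrightarrow> c u = 0" "f = comb c"
    using assms unfolding in_cone_def by blast
  then show ?thesis unfolding in_cone_def using assms(2)
    by (intro exI[of _ "\<lambda>u. a * c u"]) (auto simp: comb_scale)
qed

lemma in_cone_bd: assumes "v \<in> bd X" "v \<in> V" shows "in_cone X (W v)"
  unfolding in_cone_def using assms comb_single[of v 1]
  by (intro exI[of _ "\<lambda>u. if u = v then 1 else 0"]) auto

definition cut :: "'v \<Rightarrow> 'v \<Rightarrow> 'v \<Rightarrow> real" where
  "cut p y x = (if x \<in> br p y then W p x else 0)"

text \<open>For a node \<open>y\<close>, passing from \<open>p\<close> to \<open>y\<close> rescales
  linking numbers by the constant \<open>a\<close> off the branch and by \<open>a + b\<close> on it;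
  the edge determinant condition makes the second constant larger. A leaf has
  \<open>a = 0\<close>.\<close>

lemma W_adjacent:
  assumes p: "p \<in> N" and y: "y \<in> nb p"
  obtains a b where "a \<ge> 0" "b > 0" "\<And>x. W y x = a * W p x + b * cut p y x"
proof (cases "y \<in> L")
  case True
  have "l p y > 0" using ell_pos p by blast
  then have "W y x = 0 * W p x + (1 / real (l p y)) * cut p y x" for x
    using br_leaf[OF True y] True p by (auto simp: cut_def W_leaf W_node)
  then show thesis using that[of 0 "1 / real (l p y)"] \<open>l p y > 0\<close> by simp
next
  case False
  then have yN: "y \<in> N" using N_iff nb_V y by blast
  have py: "p \<in> nb y" using nb_sym y by blast
  let ?D = "real (d p {p, y} * d y {p, y})"
  define a where "a = real (l y p) / real (dv E d p)"
  define b where "b = ?D / real (dv E d p) - a"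
  have dp: "real (dv E d p) > 0" using dv_pos p by simp
  have "real (l y p) < ?D" using edge_det_nb[OF yN p py] by (simp add: insert_commute mult.commute del: of_nat_mult)
  then have b: "b > 0" using dp by (simp add: a_def b_def field_simps)
  have yb: "y \<in> br p y" using br_separates(2) y by blast
  have "W y x = a * W p x + b * cut p y x" for x
  proof (cases "x \<in> L")
    case x: True
    show ?thesis
    proof (cases "x \<in> br p y")
      case True
      have "real (l p x) * ?D = real (dv E d p) * real (l y x)"
        using ell_step[OF p yN True] by (metis of_nat_mult)
      then have "real (l y x) = ?D / real (dv E d p) * real (l p x)" using dp by (simp add: field_simps)
      then show ?thesis using x True p yN by (simp add: W_node cut_def b_def algebra_simps)
    next
      case False
      have "real (l y x) * real (dv E d p) = real (l y p) * real (l p x)"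
        using ell_outside[OF yN p yb L_V[OF x] False] by (metis of_nat_mult)
      then have "real (l y x) = a * real (l p x)" using dp by (simp add: a_def field_simps)
      then show ?thesis using x False p yN by (simp add: W_node cut_def)
    qed
  next
    case False then show ?thesis using p yN by (simp add: W_node cut_def)
  qed
  then show thesis using that[of a b] b by (simp add: a_def)
qed

text \<open>Since \<open>b > 0\<close>, each relation can be divided by \<open>b\<close> to give its
  cut coefficient 1; the parts along \<open>W v\<close> accumulate in \<open>A\<close>.\<close>

lemma in_cone_branches:
  assumes "finite Z"
    and "\<And>z. z \<in> Z \<Longrightarrow> \<exists>a b. a \<ge> 0 \<and> b > 0 \<and> in_cone X (\<lambda>x. a * W v x + b * cut v z x)"
  shows "\<exists>A\<ge>0. in_cone X (\<lambda>x. A * W v x + (\<Sum>z\<in>Z. cut v z x))"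
  using assms
proof (induction Z)
  case empty
  have "in_cone X (\<lambda>x. 0)" unfolding in_cone_def by (intro exI[of _ "\<lambda>_. 0"]) (auto simp: comb_def)
  then show ?case by (intro exI[of _ 0]) simp
next
  case (insert z Z)
  obtain A where A: "A \<ge> 0" "in_cone X (\<lambda>x. A * W v x + (\<Sum>z\<in>Z. cut v z x))" using insert by blast
  obtain a b where ab: "a \<ge> 0" "b > 0" "in_cone X (\<lambda>x. a * W v x + b * cut v z x)"
    using insert.prems by blast
  have "in_cone X (\<lambda>x. (A * W v x + (\<Sum>z\<in>Z. cut v z x)) + 1 / b * (a * W v x + b * cut v z x))"
    using ab(2) by (intro in_cone_add[OF A(2) in_cone_scale[OF ab(3)]]) simp
  moreover have "(A * W v x + (\<Sum>z\<in>Z. cut v z x)) + 1 / b * (a * W v x + b * cut v z x) =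
    (A + a / b) * W v x + (\<Sum>z\<in>insert z Z. cut v z x)" for x
    using insert.hyps ab(2) by (simp add: field_simps)
  ultimately show ?case using A(1) ab by (intro exI[of _ "A + a / b"]) simp
qed

lemma sum_cut:
  assumes "finite Z"
  shows "(\<Sum>z\<in>Z. cut v z x) = (if x \<in> (\<Union>z\<in>Z. br v z) then W v x else 0)"
proof (cases "x \<in> (\<Union>z\<in>Z. br v z)")
  case True
  then obtain z where z: "z \<in> Z" "x \<in> br v z" by blast
  then have "x \<in> br v z' \<longleftrightarrow> z' = z" for z' using br_disjoint by metis
  then have "(\<Sum>z\<in>Z. cut v z x) = (\<Sum>z'\<in>Z. if z' = z then W v x else 0)"
    unfolding cut_def by (intro sum.cong) auto
  then show ?thesis using z assms True by simp
qed (auto simp: cut_def)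

lemma cut_in_cone:
  assumes X: "star_sub X" and "p \<in> X" "p \<in> N" "y \<in> X" "y \<in> nb p"
  shows "\<exists>a b. a \<ge> 0 \<and> b > 0 \<and> in_cone X (\<lambda>x. a * W p x + b * cut p y x)"
  using assms(2-)
proof (induction "card (br p y)" arbitrary: p y rule: less_induct)
  case less
  obtain a b where ab: "a \<ge> 0" "b > 0" "\<And>x. W y x = a * W p x + b * cut p y x"
    using W_adjacent less.prems by blast
  show ?case
  proof (cases "y \<in> bd X")
    case True
    then have "in_cone X (W y)" using in_cone_bd star_sub_V[OF X] less.prems by blast
    then have "in_cone X (\<lambda>x. a * W p x + b * cut p y x)" unfolding ab(3)[abs_def] by simp
    then show ?thesis using ab by blast
  next
    case False
    note inn = inner[OF X less.prems(3) False]
    let ?Z = "{z. {y, z} \<in> E \<and> z \<noteq> p}"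
    have Z: "?Z \<subseteq> nb y" by (auto simp: nb_def)
    then have fZ: "finite ?Z" using finite_nb finite_subset by blast
    have py: "{p, y} \<in> E" using less.prems by auto
    have "\<exists>a b. a \<ge> 0 \<and> b > 0 \<and> in_cone X (\<lambda>x. a * W y x + b * cut y z x)" if z: "z \<in> ?Z" for z
      using less.hyps[of y z] card_br_less[OF py, of z] less.prems inn Z z by blast
    then obtain A where A: "A \<ge> 0" "in_cone X (\<lambda>x. A * W y x + (\<Sum>z\<in>?Z. cut y z x))"
      using in_cone_branches[OF fZ] by blast
    have "y \<notin> L" using inn N_iff N_V by blast
    then have Wy: "W y y = 0" using W_off N_V inn by blast
    \<comment> \<open>The branches beyond \<open>y\<close> fill \<open>br p y\<close> except for
      \<open>y\<close>, where \<open>W y\<close> vanishes. On \<open>br p y\<close> the vector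
      \<open>W y\<close> equals \<open>(a + b) * W p\<close>, which explains the coefficient
      \<open>A * b + a + b\<close>.\<close>
    have "(\<Sum>z\<in>?Z. cut y z x) = (if x \<in> br p y then W y x else 0)" for x
      unfolding sum_cut[OF fZ] br_unfold[OF py] using Wy by auto
    then have "A * W y x + (\<Sum>z\<in>?Z. cut y z x) = (A * a) * W p x + (A * b + a + b) * cut p y x" for x
      by (simp add: ab(3) cut_def algebra_simps)
    then have "in_cone X (\<lambda>x. (A * a) * W p x + (A * b + a + b) * cut p y x)" using A(2) by simp
    moreover have "A * a \<ge> 0" "A * b + a + b > 0" using A ab by (auto intro: add_nonneg_pos)
    ultimately show ?thesis by blast
  qed
qed

text \<open>The cuts at \<open>v\<close> over all neighbours add up to \<open>W v\<close>, so the
  cone contains \<open>(A + 1) * W v\<close>.\<close>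

lemma inner_in_cone:
  assumes X: "star_sub X" and v: "v \<in> X" "v \<notin> bd X" shows "in_cone X (W v)"
proof -
  note inn = inner[OF X v]
  have "\<exists>a b. a \<ge> 0 \<and> b > 0 \<and> in_cone X (\<lambda>x. a * W v x + b * cut v z x)" if "z \<in> nb v" for z
    using cut_in_cone[OF X v(1) inn(2)] inn that by blast
  then obtain A where A: "A \<ge> 0" "in_cone X (\<lambda>x. A * W v x + (\<Sum>z\<in>nb v. cut v z x))"
    using in_cone_branches[OF finite_nb] by blast
  have "v \<notin> L" using inn N_iff N_V by blast
  have "(\<Sum>z\<in>nb v. cut v z x) = W v x" for x
  proof (cases "x \<in> V \<and> x \<noteq> v")
    case True
    then obtain z where "x \<in> br v z" using br_obtain N_V[OF inn(2)] by blast
    then show ?thesis unfolding sum_cut[OF finite_nb] using br_nb by auto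
  next
    case False
    then have "W v x = 0" using W_off[OF N_V[OF inn(2)]] L_V \<open>v \<notin> L\<close> by metis
    then show ?thesis unfolding sum_cut[OF finite_nb] by simp
  qed
  then have "in_cone X (\<lambda>x. 1 / (A + 1) * ((A + 1) * W v x))"
    using in_cone_scale[OF A(2), of "1 / (A + 1)"] A(1) by (simp add: algebra_simps)
  then show ?thesis using A(1) by simp
qed

text \<open>Subtracting the largest admissible multiple of \<open>W v\<close> moves the weight vector to a face of the
  cone over the leaves of the subtree, joined with \<open>v\<close>.\<close>

lemma subtract_inner:
  assumes X: "star_sub X" and v: "v \<in> X" "v \<notin> bd X"
    and s: "\<forall>u. s u \<ge> 0" "\<And>u. u \<notin> bd X \<Longrightarrow> u \<noteq> v \<Longrightarrow> s u = 0"
  obtains t u0 where "\<forall>u. t u \<ge> 0" "\<And>u. u \<notin> bd X \<Longrightarrow> u \<noteq> v \<Longrightarrow> t u = 0"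
    "u0 \<in> bd X" "t u0 = 0" "comb t = comb s"
proof -
  note inn = inner[OF X v]
  have vV: "v \<in> V" using inn N_V by blast
  obtain c where c: "\<forall>u. c u \<ge> 0" "\<forall>u. u \<notin> bd X \<longrightarrow> c u = 0" "W v = comb c"
    using inner_in_cone[OF X v] unfolding in_cone_def by blast
  let ?G = "{u \<in> bd X. c u > 0}"
  have fG: "finite ?G" using finite_star_sub[OF X] by (simp add: bd_def)
  have "?G \<noteq> {}"
  proof
    assume "?G = {}"
    then have "c u = 0" for u using c by (metis (mono_tags, lifting) empty_iff less_eq_real_def mem_Collect_eq)
    then have 0: "W v x = 0" for x using c(3) by (simp add: comb_def)
    obtain y where "y \<in> nb v" using N_card[OF inn(2)] by fastforce
    then obtain x where "x \<in> L" using alpha_pos_obtain inn by blast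
    then show False using 0[of x] inn ell_pos[of v x] by (simp add: W_node)
  qed
  \<comment> \<open>Ratio test: the minimum keeps every \<open>s u - r * c u\<close> nonnegative and
    makes it vanish at a minimiser \<open>u0\<close>.\<close>
  define r where "r = Min ((\<lambda>u. s u / c u) ` ?G)"
  have "r \<in> (\<lambda>u. s u / c u) ` ?G" unfolding r_def using fG \<open>?G \<noteq> {}\<close> by (intro Min_in) auto
  then obtain u0 where u0: "u0 \<in> ?G" "r = s u0 / c u0" by blast
  have r0: "r \<ge> 0" using u0 s c by simp
  have r: "r * c u \<le> s u" for u
  proof (cases "u \<in> ?G")
    case True
    then have "r \<le> s u / c u" unfolding r_def using fG by (intro Min_le) auto
    then show ?thesis using True by (simp add: field_simps)
  next
    case False
    then have "c u = 0" using c by (metis (mono_tags, lifting) less_eq_real_def mem_Collect_eq)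
    then show ?thesis using s by simp
  qed
  define t where "t u = (s u + (- r) * c u) + (if u = v then r else 0)" for u
  have "comb t = comb s"
  proof
    fix x
    have "comb t x = comb s x + (- r) * comb c x + r * W v x"
      unfolding t_def comb_add comb_scale comb_single[OF vV] ..
    then show "comb t x = comb s x" using c(3) by simp
  qed
  moreover have "\<forall>u. t u \<ge> 0" using r r0 by (simp add: t_def)
  moreover have "t u = 0" if "u \<notin> bd X" "u \<noteq> v" for u using that s c by (simp add: t_def)
  moreover have "u0 \<noteq> v" using u0 v by blast
  then have "t u0 = 0" using u0 by (simp add: t_def)
  ultimately show thesis using that u0 by blast
qed

text \<open>Keeping \<open>p\<close> together with its branch makes \<open>p\<close> a boundary
  vertex of the smaller piece, so support at \<open>p\<close> is harmless there; within the branch,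
  neighbourhoods in \<open>X\<close> are unchanged.\<close>

lemma star_sub_branch:
  assumes X: "star_sub X" and p: "p \<in> X" and z: "z \<in> nb p" "z \<in> X"
  shows "star_sub (X \<inter> insert p (br p z))" (is "star_sub ?Y")
    and "p \<in> bd (X \<inter> insert p (br p z))" "bd X \<inter> br p z \<subseteq> bd (X \<inter> insert p (br p z))"
proof -
  have pz: "{p, z} \<in> E" using z by auto
  have near: "x' \<in> insert p (br p z)" if "x \<in> br p z" "x' \<in> nb x" for x x'
    using br_separates(4)[OF pz, of x x'] that by auto
  have nbp: "nb p \<inter> ?Y \<subseteq> {z}"
  proof
    fix x assume x: "x \<in> nb p \<inter> ?Y"
    then have "x \<in> br p z" using nb_V(3) by blast
    moreover have "x \<in> br p x" using br_separates(2) x by blast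
    ultimately show "x \<in> {z}" using br_disjoint by blast
  qed
  have cp: "card (nb p \<inter> ?Y) \<le> 1" using card_mono[OF _ nbp] by simp
  have nbx: "nb x \<inter> ?Y = nb x \<inter> X" if "x \<in> br p z" for x using near[OF that] by blast
  show "p \<in> bd ?Y" using cp p by (simp add: bd_def)
  show "bd X \<inter> br p z \<subseteq> bd ?Y" using nbx by (auto simp: bd_def)
  show "star_sub ?Y" unfolding star_sub_def
  proof (intro conjI ballI allI impI)
    show "?Y \<subseteq> V" using X by (auto simp: star_sub_def)
  next
    fix y z' assume y: "y \<in> ?Y" and "?Y \<inter> br y z' \<noteq> {}"
    then obtain x where x: "x \<in> ?Y" "x \<in> br y z'" by blast
    have "z' \<in> X" using star_sub_step[OF X _ _ x(2)] x(1) y by blast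
    moreover have "z' \<in> insert p (br p z)"
    proof (cases "y = p")
      case True
      then have "x \<noteq> p" using x br_separates(1) br_edge by metis
      then have "x \<in> br p z" using x by blast
      then have "z' = z" using br_disjoint x True by blast
      then show ?thesis using br_separates(2)[OF pz] by blast
    next
      case False
      then show ?thesis using near[OF _ br_nb[OF x(2)]] y by blast
    qed
    ultimately show "z' \<in> ?Y" by blast
  next
    fix x assume x: "x \<in> ?Y"
    show "nb x \<subseteq> ?Y \<or> card (nb x \<inter> ?Y) \<le> 1"
    proof (cases "x = p")
      case False
      then have xb: "x \<in> br p z" using x by blast
      have "nb x \<subseteq> X \<or> card (nb x \<inter> X) \<le> 1" using X x by (auto simp: star_sub_def)
      then show ?thesis using nbx[OF xb] near[OF xb] by auto
    qed (use cp in simp)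
  qed
qed

text \<open>The extra vertex \<open>v\<close> carries the weight exchanged by
  \<open>subtract_inner\<close>. That exchange changes the coefficients, hence the new
  \<open>t\<close> with the same \<open>comb\<close>.\<close>

lemma trop_in_edge:
  assumes "star_sub X" "v \<in> X" "\<forall>u. s u \<ge> 0" "\<And>u. u \<notin> bd X \<Longrightarrow> u \<noteq> v \<Longrightarrow> s u = 0"
    and "comb s \<in> trop_pos V E F"
  shows "\<exists>a b t. a \<in> X \<and> b \<in> X \<and> (a = b \<or> b \<in> nb a) \<and> (\<forall>u. t u \<ge> 0) \<and>
     (\<forall>u. u \<noteq> a \<and> u \<noteq> b \<longrightarrow> t u = 0) \<and> comb t = comb s"
  using assms
proof (induction "card X" arbitrary: X v s rule: less_induct)
  case less
  note X = less.prems(1)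
  show ?case
  proof (cases "X \<subseteq> bd X")
    case True
    have sX: "s u = 0" if "u \<notin> X" for u using less.prems(2,4) that bd_subset by metis
    show ?thesis
    proof (cases "X = {v}")
      case True
      then show ?thesis using less.prems(3) sX by (intro exI[of _ v] exI[of _ s]) auto
    next
      case False
      then obtain x where x: "x \<in> X" "x \<noteq> v" using less.prems(2) by blast
      then obtain z where z: "x \<in> br v z" using br_obtain star_sub_V[OF X] less.prems(2) by metis
      have zX: "z \<in> X" using star_sub_step[OF X less.prems(2) x(1) z] .
      have "X \<subseteq> {z, v}" using bd_pair[OF X _ _ br_nb[OF z]] zX less.prems(2) True by blast
      then have "s u = 0" if "u \<noteq> v" "u \<noteq> z" for u using sX that by blast
      then show ?thesis using zX less.prems(2,3) br_nb[OF z]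
        by (intro exI[of _ v] exI[of _ z] exI[of _ s]) auto
    qed
  next
    case False
    \<comment> \<open>If \<open>v\<close> is inner it has to be kept as the extra vertex; if it lies
      on the boundary, any inner vertex is available.\<close>
    obtain v1 where v1: "v1 \<in> X" "v1 \<notin> bd X" "\<And>u. u \<notin> bd X \<Longrightarrow> u \<noteq> v1 \<Longrightarrow> s u = 0"
    proof (cases "v \<in> bd X")
      case True
      then show thesis using that False less.prems(4) by (metis subsetI)
    qed (use that less.prems in blast)
    obtain t u0 where t: "\<forall>u. t u \<ge> 0" "\<And>u. u \<notin> bd X \<Longrightarrow> u \<noteq> v1 \<Longrightarrow> t u = 0"
      and u0: "u0 \<in> bd X" "t u0 = 0" and ts: "comb t = comb s"
      using subtract_inner[OF X v1(1,2) less.prems(3) v1(3)] by blast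
    have tX: "t u = 0" if "u \<notin> X" for u using t(2) v1(1) that bd_subset by metis
    have u0X: "u0 \<in> X" using bd_subset u0 by blast
    have "v1 \<noteq> u0" using u0 v1 by blast
    \<comment> \<open>\<open>p\<close> is the neighbour of \<open>u0\<close> towards
      \<open>v1\<close>. It is inner, since two adjacent boundary vertices would exhaust
      \<open>X\<close>.\<close>
    then obtain p where p: "v1 \<in> br u0 p" using br_obtain star_sub_V[OF X] u0X v1(1) by metis
    have pX: "p \<in> X" using star_sub_step[OF X u0X v1(1) p] .
    have pu: "p \<in> nb u0" "u0 \<in> nb p" using br_nb[OF p] nb_sym by blast+
    have pi: "p \<notin> bd X"
    proof
      assume "p \<in> bd X"
      then have "X \<subseteq> {p, u0}" using bd_pair[OF X _ u0(1) pu(1)] by blast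
      then show False using v1 u0 \<open>p \<in> bd X\<close> by blast
    qed
    \<comment> \<open>Nothing of \<open>X\<close> lies beyond \<open>u0\<close>, and
      \<open>u0\<close> has lost its support: this is the empty branch needed at
      \<open>p\<close>.\<close>
    have "br p u0 \<inter> X = {u0}" using br_bd[OF X u0(1) pX pu(2)] .
    then have no: "t u = 0" if "u \<in> br p u0" for u using that tX[of u] u0(2) by (cases "u \<in> X") auto
    have trop: "comb t \<in> trop_pos V E F" using less.prems(5) ts by simp
    obtain z where z: "z \<in> nb p" "z \<noteq> u0" "\<And>u z'. u \<in> br p z' \<Longrightarrow> z' \<noteq> z \<Longrightarrow> t u = 0"
      using one_supported_branch[OF X t(1) tX trop pX pi pu(2) no] by blast
    have zX: "z \<in> X" using inner(1)[OF X pX pi] z by blast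
    let ?Y = "X \<inter> insert p (br p z)"
    note Y = star_sub_branch[OF X pX z(1) zX]
    have "u0 \<in> br p u0" using br_separates(2) pu(2) by blast
    then have "u0 \<notin> ?Y" using br_disjoint z(2) nb_V(3)[OF pu(2)] by blast
    then have card: "card ?Y < card X"
      using u0X finite_star_sub[OF X] by (intro psubset_card_mono) auto
    \<comment> \<open>If \<open>v1\<close> is cut off, it lies in an unsupported branch at
      \<open>p\<close>. Then \<open>p\<close>, a boundary vertex of \<open>?Y\<close>, merely fills
      the place of the extra vertex.\<close>
    define v' where "v' = (if v1 \<in> ?Y then v1 else p)"
    have v': "v' \<in> ?Y" using pX by (simp add: v'_def)
    have supp: "t u = 0" if u: "u \<notin> bd ?Y" "u \<noteq> v'" for u
    proof (rule ccontr)
      assume "t u \<noteq> 0"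
      then have uX: "u \<in> X" and ub: "u \<in> bd X \<or> u = v1" using tX t(2) by blast+
      have "u \<noteq> p" using u(1) Y(2) by blast
      then obtain z' where z': "u \<in> br p z'" using br_obtain star_sub_V[OF X] uX pX by metis
      then have "z' = z" using z(3) \<open>t u \<noteq> 0\<close> by blast
      then have ubr: "u \<in> br p z" using z' by simp
      then have "u \<noteq> v1" using uX u(2) by (auto simp: v'_def)
      then show False using ub ubr Y(3) u(1) by blast
    qed
    from less.hyps[OF card Y(1) v' t(1) supp trop] show ?thesis unfolding ts by blast
  qed
qed

section \<open>Normalisation and return to the given subtree\<close>

definition W_norm :: "'v \<Rightarrow> real" where "W_norm u = (\<Sum>x\<in>L. \<bar>W u x\<bar>)"

lemma rho_W: "rho V E d u x = W u x / W_norm u"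
  by (simp add: rho_def Let_def W_norm_def)

lemma W_norm_sum: "u \<in> V \<Longrightarrow> W_norm u = (\<Sum>x\<in>L. W u x)"
  unfolding W_norm_def by (intro sum.cong) (simp_all add: W_nonneg)

lemma W_norm_pos: assumes "u \<in> V" shows "W_norm u > 0"
proof -
  have "\<exists>x\<in>L. W u x > 0"
  proof (cases "u \<in> L")
    case True then show ?thesis by (auto simp: W_leaf)
  next
    case False
    then have u: "u \<in> N" using N_iff assms by blast
    then obtain y where "y \<in> nb u" using N_card by fastforce
    then obtain x where "x \<in> L" using alpha_pos_obtain u by blast
    then show ?thesis using u ell_pos by (intro bexI[of _ x]) (simp_all add: W_node)
  qed
  then obtain x where "x \<in> L" "W u x > 0" by blast
  then show ?thesis unfolding W_norm_sum[OF assms] using finite_LN assms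
    by (intro sum_pos2[of _ x]) (simp_all add: W_nonneg)
qed

lemma sum_comb: "(\<Sum>x\<in>L. comb s x) = (\<Sum>u\<in>V. s u * W_norm u)"
proof -
  have "(\<Sum>x\<in>L. comb s x) = (\<Sum>u\<in>V. s u * (\<Sum>x\<in>L. W u x))"
    unfolding comb_def by (subst sum.swap) (simp add: sum_distrib_left)
  then show ?thesis by (simp add: W_norm_sum)
qed

text \<open>A walk inside the subtree can enter the branch only across the bridge
  \<open>{y, z}\<close>, so this edge belongs to \<open>ET\<close>.\<close>

lemma subtree_edge:
  assumes T: "subtree V E VT ET" and y: "y \<in> VT" and x: "x \<in> VT" "x \<in> br y z"
  shows "{y, z} \<in> ET"
proof -
  obtain p where p: "is_walk ET p" "hd p = y" "last p = x"
    using T x y unfolding subtree_def connected_graph_def by meson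
  have yz: "{y, z} \<in> E" using br_edge x by blast
  obtain a b where ab: "a \<notin> br y z" "b \<in> br y z" "{a, b} \<in> ET"
    using is_walk_stays[of ET p "- br y z"] p x br_separates(1)[OF yz]
    unfolding is_walk_def by auto
  then have "{b, a} \<in> E" using T by (auto simp: subtree_def insert_commute)
  then have "b = z \<and> a = y" using br_separates(4)[OF yz] ab by blast
  then show ?thesis using ab by simp
qed

lemma subtree_star_sub:
  assumes T: "subtree V E VT ET" and sf: "star_full E VT ET"
  shows "star_sub VT" "subtree_leaves VT ET \<subseteq> bd VT"
    and "\<And>a b. a \<in> VT \<Longrightarrow> b \<in> VT \<Longrightarrow> b \<in> nb a \<Longrightarrow> {a, b} \<in> ET"
proof -
  have ET: "e \<subseteq> VT" if "e \<in> ET" for e using T that by (auto simp: subtree_def)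
  have VT: "VT \<subseteq> V" "ET \<subseteq> E" using T by (auto simp: subtree_def)
  show edge: "{a, b} \<in> ET" if "a \<in> VT" "b \<in> VT" "b \<in> nb a" for a b
    using subtree_edge[OF T that(1,2)] br_separates(2) that(3) by blast
  have leaf: "card (nb x \<inter> VT) \<le> 1" if x: "x \<in> VT" "valency ET x \<le> 1" for x
  proof -
    have "(\<lambda>y. {x, y}) ` (nb x \<inter> VT) \<subseteq> {e \<in> ET. x \<in> e}" using edge x by auto
    moreover have "finite {e \<in> ET. x \<in> e}" using finite_E VT finite_subset by fastforce
    ultimately have "card ((\<lambda>y. {x, y}) ` (nb x \<inter> VT)) \<le> valency ET x"
      unfolding valency_def by (rule card_mono[rotated])
    moreover have "inj_on (\<lambda>y. {x, y}) (nb x \<inter> VT)" using inj_nb by (rule inj_on_subset) simp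
    ultimately show ?thesis using x by (simp add: card_image)
  qed
  then show "subtree_leaves VT ET \<subseteq> bd VT" by (auto simp: subtree_leaves_def bd_def)
  show "star_sub VT" unfolding star_sub_def
  proof (intro conjI ballI allI impI)
    show "VT \<subseteq> V" by (rule VT)
    show "z \<in> VT" if "y \<in> VT" "VT \<inter> br y z \<noteq> {}" for y z
      using subtree_edge[OF T that(1), of _ z] that(2) ET by blast
    show "nb x \<subseteq> VT \<or> card (nb x \<inter> VT) \<le> 1" if x: "x \<in> VT" for x
    proof (cases "valency ET x \<le> 1")
      case False
      then have "{x, y} \<in> ET" if "y \<in> nb x" for y
        using sf x that nb_edge unfolding star_full_def subtree_nodes_def by auto
      then show ?thesis using ET by blast
    qed (use leaf x in blast)
  qed
qed

lemma trop_subset_rho_image: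
  assumes T: "subtree V E VT ET" and sf: "star_full E VT ET"
    and w: "w \<in> conv_rho V E d (subtree_leaves VT ET)" "w \<in> trop_pos V E F"
  shows "w \<in> rho_image V E d VT ET"
proof -
  let ?P = "subtree_leaves VT ET"
  note X = subtree_star_sub[OF T sf]
  have VT: "VT \<subseteq> V" using T by (auto simp: subtree_def)
  then have PV: "?P \<subseteq> V" by (auto simp: subtree_leaves_def)
  obtain c where c: "w = (\<lambda>x. \<Sum>u\<in>?P. c u * rho V E d u x)" "\<forall>u\<in>?P. c u \<ge> 0" "(\<Sum>u\<in>?P. c u) = 1"
    using w(1) unfolding conv_rho_def by blast
  define s where "s u = (if u \<in> ?P then c u / W_norm u else 0)" for u
  have w_eq: "w = comb s"
  proof
    fix x
    have "comb s x = (\<Sum>u\<in>?P. s u * W u x)" unfolding comb_def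
      using PV finite_V by (intro sum.mono_neutral_right) (auto simp: s_def)
    then show "w x = comb s x" by (simp add: c(1) s_def rho_W)
  qed
  have "(\<Sum>u\<in>V. s u * W_norm u) = (\<Sum>u\<in>?P. s u * W_norm u)"
    using PV finite_V by (intro sum.mono_neutral_right) (auto simp: s_def)
  also have "\<dots> = (\<Sum>u\<in>?P. c u)"
    using W_norm_pos PV by (intro sum.cong) (auto simp: s_def less_le)
  \<comment> \<open>Total mass 1 depends on \<open>comb s\<close> only, so it passes to the
    coefficients \<open>t\<close> found below and makes them barycentric on an edge once multiplied
    by the norms.\<close>
  finally have one: "(\<Sum>x\<in>L. comb s x) = 1" using c(3) by (simp add: sum_comb)
  have s0: "\<forall>u. s u \<ge> 0" using c(2) PV W_norm_pos by (auto simp: s_def less_imp_le)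
  have s1: "s u = 0" if "u \<notin> bd VT" for u using X(2) that by (auto simp: s_def)
  obtain v where "v \<in> VT" using T by (auto simp: subtree_def connected_graph_def)
  from trop_in_edge[OF X(1) this s0 s1] w w_eq obtain a b t
    where ab: "a \<in> VT" "b \<in> VT" "a = b \<or> b \<in> nb a" and t: "\<forall>u. t u \<ge> 0" "\<forall>u. u \<noteq> a \<and> u \<noteq> b \<longrightarrow> t u = 0"
      "comb t = comb s" by blast
  have aV: "a \<in> V" "b \<in> V" using ab VT by auto
  note na = W_norm_pos[OF aV(1)] and nb = W_norm_pos[OF aV(2)]
  have two: "(\<Sum>u\<in>V. t u * f u) = (\<Sum>u\<in>{a, b}. t u * f u)" for f
    using aV finite_V t(2) by (intro sum.mono_neutral_right) auto
  have tw: "(\<Sum>u\<in>{a, b}. t u * W_norm u) = 1"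
    using one sum_comb[of t] t(3) two by simp
  have wx: "w x = (\<Sum>u\<in>{a, b}. t u * W u x)" for x
    unfolding w_eq t(3)[symmetric] comb_def by (rule two)
  show ?thesis
  proof (cases "a = b")
    case True
    then have "t a = 1 / W_norm a" using tw na by (simp add: field_simps)
    then have "w = rho V E d a" using True wx by (auto simp: rho_W)
    then show ?thesis using ab by (auto simp: rho_image_def)
  next
    case False
    define r where "r = t b * W_norm b"
    have r: "1 - r = t a * W_norm a" using tw False by (simp add: r_def)
    have "0 \<le> r" using t(1) nb by (simp add: r_def)
    moreover have "0 \<le> 1 - r" unfolding r using t(1) na by simp
    moreover have "w = (\<lambda>x. (1 - r) * rho V E d a x + r * rho V E d b x)"
      using wx False na nb unfolding r by (auto simp: rho_W r_def)
    ultimately have "w \<in> fseg (rho V E d a) (rho V E d b)" unfolding fseg_def by auto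
    moreover have "{a, b} \<in> ET" using X(3) ab False by blast
    ultimately show ?thesis unfolding rho_image_def by blast
  qed
qed

end

theorem theorem6p5:
  fixes V :: "'v set" and E :: "'v set set" and d :: "'v \<Rightarrow> 'v set \<Rightarrow> nat"
    and \<alpha> :: "'v \<Rightarrow> 'v set \<Rightarrow> 'v \<Rightarrow> nat" and F :: "'v \<Rightarrow> nat \<Rightarrow> 'v pseries"
    and VT :: "'v set" and ET :: "'v set set"
  assumes "splice_diagram V E d"
    and "edge_determinant_condition V E d"
    and "semigroup_condition V E d"
    and "admissible_alpha V E d \<alpha>"
    and "splice_type_system V E d \<alpha> F"
    and "subtree V E VT ET"
    and "star_full E VT ET"
  shows "conv_rho V E d (subtree_leaves VT ET) \<inter> trop_pos V E F \<subseteq> rho_image V E d VT ET"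
proof
  fix w assume w: "w \<in> conv_rho V E d (subtree_leaves VT ET) \<inter> trop_pos V E F"
  interpret splice V E d \<alpha> F
    using assms(1,2,4,5) by unfold_locales (auto simp: splice_diagram_def)
  show "w \<in> rho_image V E d VT ET"
    using trop_subset_rho_image[OF assms(6,7)] w by blast
qed

end
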